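(* There exists a constant $C>0$ (independent of the mesh size $h$ and of the parameters $\kappa,\sigma,\epsilon$) such that for every $\epsilon>0$, with $\Lambda_\epsilon^c$ denoting the complement of the $\epsilon$-pseudospectrum of the matrix $AB^{-1}$, $$\left\{z\in\mathbb{C} \;\Big|\; C\left(\frac{1}{|z|^2-\operatorname{Re} z}+\frac{1}{|1-z|}\right)<\frac{1}{\epsilon}\right\}\setminus\overline{B\left(\tfrac12,\tfrac12\right)}\subset\Lambda_\epsilon^c .$$
   Context: $\Omega\subset\mathbb{R}^d$, $d=2,3$, is a bounded domain with Lipschitz boundary; $\mathcal{T}$ is a shape regular triangular/tetrahedral partition of $\Omega$ with mesh size $h$; $V:=\{u\in H^1(\Omega) : u|_K\in P^1(K)\ \forall K\in\mathcal{T}\}$ is the (complex-valued) first-order Lagrange finite element space with the (real-valued) nodal basis $\{\varphi_i\}_{i=1}^N$, and for $u\in V$, $\vec{x}_u\in\mathbb{C}^N$ is its coefficient vector, $u=\sum_i(\vec{x}_u)_i\varphi_i$. Let $\kappa>0$ and $\sigma>0$ be real, let $(\cdot,\cdot)$ be the $L^2(\Omega)$ inner product and $(\cdot,\cdot)_{\partial\Omega}$ the $L^2(\partial\Omega)$ inner product (linear in the first, antilinear in the second argument), and define $$a(u,v)=(\nabla u,\nabla v)+\mathrm{i}\kappa(u,v)_{\partial\Omega}-\kappa^2(u,v),\qquad b(u,v)=a(u,v)+\mathrm{i}\sigma(u,v).$$ The matrices $A,B\in\mathbb{C}^{N\times N}$ are $A_{ij}=a(\varphi_j,\varphi_i)$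 and $B_{ij}=b(\varphi_j,\varphi_i)$ ($B$ is the shifted-Laplace preconditioner). $|\cdot|$ is the Euclidean norm of vectors and spectral norm of matrices. For a matrix $M$, $\Lambda_\epsilon(M)=\{z\in\mathbb{C} : |(zI-M)^{-1}|\ge\epsilon^{-1}\}$, with $|(zI-M)^{-1}|=\infty$ if $zI-M$ is singular, and $\Lambda_\epsilon^c(M)=\{z\in\mathbb{C}: |(zI-M)^{-1}|<\epsilon^{-1}\}$. $B(z_0,r)=\{z\in\mathbb{C} : |z-z_0|<r\}$ denotes an open disc (not to be confused with the matrix $B$), the bar denotes closure. Standing norm equivalence: there are constants $c_1,C_1>0$ independent of $h$ with $c_1h^{d/2}|\vec{x}_u|\le\|u\|_0\le C_1h^{d/2}|\vec{x}_u|$ for all $u\in V$, where $\|\cdot\|_0$ is the $L^2(\Omega)$ norm. The constant $C$ of the claim may depend on $\Omega$, the shape regularity constant of $\mathcal{T}$, and $c_1,C_1$. *)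

theory Defs
  imports
    "HOL-Analysis.Analysis"
    "Jordan_Normal_Form.Gauss_Jordan_Elimination"
begin

(* In this file "$" and "inner" refer to real ^ 'd and complex ^ 'd; the size-dependent
   matrices and coefficient vectors are those of Jordan_Normal_Form. *)
no_notation Matrix.vec_index (infixl "$" 100)


section \<open>Domains\<close>

text \<open>
  Near each boundary point the domain is the strict epigraph, in some direction \<open>e\<close>, of a
  Lipschitz function of the component orthogonal to \<open>e\<close>. That \<open>g\<close> is defined on the whole
  space is no restriction, since a function on the hyperplane extends by projection.
\<close>

definition bounded_lipschitz_domain :: "(real ^ 'd) set \<Rightarrow> bool" where
  "bounded_lipschitz_domain \<Omega> \<longleftrightarrow>
     open \<Omega> \<and> connected \<Omega> \<and> \<Omega> \<noteq> {} \<and> bounded \<Omega> \<and>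
     (\<forall>p\<in>frontier \<Omega>. \<exists>r>0. \<exists>e g L. norm e = 1 \<and> L-lipschitz_on UNIV g \<and>
        \<Omega> \<inter> ball p r = {y \<in> ball p r. g (y - inner e y *\<^sub>R e) < inner e y})"


section \<open>Surface measure\<close>

text \<open>
  The \<open>n\<close>-dimensional Hausdorff measure for \<open>n \<ge> 1\<close>, normalised so as to agree with
  \<open>n\<close>-dimensional volume. The outer measure is a metric outer measure, hence countably additive
  on Borel sets, so that \<^const>\<open>measure_of\<close> does not degenerate to the null measure here.
\<close>

definition hausdorff_pre :: "nat \<Rightarrow> real \<Rightarrow> 'a::metric_space set \<Rightarrow> ennreal" where
  "hausdorff_pre n \<delta> A =
     (INF U\<in>{U :: nat \<Rightarrow> 'a set. A \<subseteq> (\<Union>i. U i) \<and> (\<forall>i. bounded (U i) \<and> diameter (U i) \<le> \<delta>)}.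
        \<Sum>i. ennreal (unit_ball_vol (real n) * (diameter (U i) / 2) ^ n))"

definition hausdorff_outer :: "nat \<Rightarrow> 'a::metric_space set \<Rightarrow> ennreal" where
  "hausdorff_outer n A = (SUP \<delta>\<in>{0<..}. hausdorff_pre n \<delta> A)"

definition hausdorff_measure :: "nat \<Rightarrow> 'a::metric_space measure" where
  "hausdorff_measure n = measure_of UNIV (sets borel) (hausdorff_outer n)"

definition surface_measure :: "(real ^ 'd) set \<Rightarrow> (real ^ 'd) measure" where
  "surface_measure \<Omega> = restrict_space (hausdorff_measure (CARD('d) - 1)) (frontier \<Omega>)"


section \<open>Weak gradients and \<open>H\<^sup>1\<close>\<close>

definition pderivative :: "'d \<Rightarrow> (real ^ 'd \<Rightarrow> real) \<Rightarrow> real ^ 'd \<Rightarrow> real" where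
  "pderivative k f x = frechet_derivative f (at x) (axis k 1)"

primrec Ck :: "nat \<Rightarrow> (real ^ 'd \<Rightarrow> real) \<Rightarrow> bool" where
  "Ck 0 f \<longleftrightarrow> continuous_on UNIV f"
| "Ck (Suc n) f \<longleftrightarrow> (\<forall>x. f differentiable (at x)) \<and> (\<forall>k. Ck n (pderivative k f))"

definition test_functions :: "(real ^ 'd) set \<Rightarrow> (real ^ 'd \<Rightarrow> real) set" where
  "test_functions \<Omega> =
     {\<psi>. (\<forall>n. Ck n \<psi>) \<and> compact (closure {x. \<psi> x \<noteq> 0}) \<and> closure {x. \<psi> x \<noteq> 0} \<subseteq> \<Omega>}"

definition L2 :: "(real ^ 'd) set \<Rightarrow> (real ^ 'd \<Rightarrow> complex) set" where
  "L2 \<Omega> = {u. u \<in> borel_measurable (lebesgue_on \<Omega>) \<and>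
              integrable (lebesgue_on \<Omega>) (\<lambda>x. (cmod (u x))\<^sup>2)}"

definition has_weak_gradient ::
    "(real ^ 'd) set \<Rightarrow> (real ^ 'd \<Rightarrow> complex) \<Rightarrow> (real ^ 'd \<Rightarrow> complex ^ 'd) \<Rightarrow> bool" where
  "has_weak_gradient \<Omega> u g \<longleftrightarrow>
     (\<forall>k. (\<lambda>x. g x $ k) \<in> L2 \<Omega> \<and>
        (\<forall>\<psi>\<in>test_functions \<Omega>.
           (\<integral>x. u x * of_real (pderivative k \<psi> x) \<partial>lebesgue_on \<Omega>) =
           - (\<integral>x. g x $ k * of_real (\<psi> x) \<partial>lebesgue_on \<Omega>)))"

definition H1 :: "(real ^ 'd) set \<Rightarrow> (real ^ 'd \<Rightarrow> complex) set" where
  "H1 \<Omega> = {u \<in> L2 \<Omega>. \<exists>g. has_weak_gradient \<Omega> u g}"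

text \<open>Weak gradients are unique only up to null sets, which the integrals below do not see.\<close>

definition weak_gradient ::
    "(real ^ 'd) set \<Rightarrow> (real ^ 'd \<Rightarrow> complex) \<Rightarrow> real ^ 'd \<Rightarrow> complex ^ 'd" where
  "weak_gradient \<Omega> u = (SOME g. has_weak_gradient \<Omega> u g)"

definition L2_inner ::
    "(real ^ 'd) set \<Rightarrow> (real ^ 'd \<Rightarrow> complex) \<Rightarrow> (real ^ 'd \<Rightarrow> complex) \<Rightarrow> complex" where
  "L2_inner \<Omega> u v = (\<integral>x. u x * cnj (v x) \<partial>lebesgue_on \<Omega>)"

definition L2_norm :: "(real ^ 'd) set \<Rightarrow> (real ^ 'd \<Rightarrow> complex) \<Rightarrow> real" where
  "L2_norm \<Omega> u = sqrt (\<integral>x. (cmod (u x))\<^sup>2 \<partial>lebesgue_on \<Omega>)"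

definition grad_inner ::
    "(real ^ 'd) set \<Rightarrow> (real ^ 'd \<Rightarrow> complex) \<Rightarrow> (real ^ 'd \<Rightarrow> complex) \<Rightarrow> complex" where
  "grad_inner \<Omega> u v =
     (\<integral>x. (\<Sum>k\<in>UNIV. weak_gradient \<Omega> u x $ k * cnj (weak_gradient \<Omega> v x $ k)) \<partial>lebesgue_on \<Omega>)"

text \<open>
  The arguments are meant to be continuous on \<open>closure \<Omega>\<close>, as finite element functions are, so
  that their traces are their restrictions to the boundary.
\<close>

definition bdry_inner ::
    "(real ^ 'd) set \<Rightarrow> (real ^ 'd \<Rightarrow> complex) \<Rightarrow> (real ^ 'd \<Rightarrow> complex) \<Rightarrow> complex" where
  "bdry_inner \<Omega> u v = (\<integral>x. u x * cnj (v x) \<partial>surface_measure \<Omega>)"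

definition helmholtz_form ::
    "(real ^ 'd) set \<Rightarrow> real \<Rightarrow> (real ^ 'd \<Rightarrow> complex) \<Rightarrow> (real ^ 'd \<Rightarrow> complex) \<Rightarrow> complex" where
  "helmholtz_form \<Omega> \<kappa> u v =
     grad_inner \<Omega> u v + \<i> * of_real \<kappa> * bdry_inner \<Omega> u v - of_real (\<kappa>\<^sup>2) * L2_inner \<Omega> u v"

definition shifted_form ::
    "(real ^ 'd) set \<Rightarrow> real \<Rightarrow> real \<Rightarrow>
     (real ^ 'd \<Rightarrow> complex) \<Rightarrow> (real ^ 'd \<Rightarrow> complex) \<Rightarrow> complex" where
  "shifted_form \<Omega> \<kappa> \<sigma> u v = helmholtz_form \<Omega> \<kappa> u v + \<i> * of_real \<sigma> * L2_inner \<Omega> u v"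


section \<open>Meshes and the first-order Lagrange space\<close>

definition mesh_of :: "(real ^ 'd) set \<Rightarrow> (real ^ 'd) set set \<Rightarrow> bool" where
  "mesh_of \<Omega> \<T> \<longleftrightarrow>
     triangulation \<T> \<and> (\<forall>K\<in>\<T>. int CARD('d) simplex K) \<and> \<Union>\<T> = closure \<Omega>"

definition mesh_size :: "(real ^ 'd) set set \<Rightarrow> real" where
  "mesh_size \<T> = Max (diameter ` \<T>)"

definition inball_diameter :: "(real ^ 'd) set \<Rightarrow> real" where
  "inball_diameter K = Sup {2 * r | x r. 0 \<le> r \<and> cball x r \<subseteq> K}"

definition shape_regular :: "real \<Rightarrow> (real ^ 'd) set set \<Rightarrow> bool" where
  "shape_regular \<gamma> \<T> \<longleftrightarrow> (\<forall>K\<in>\<T>. diameter K \<le> \<gamma> * inball_diameter K)"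

definition mesh_vertices :: "(real ^ 'd) set set \<Rightarrow> (real ^ 'd) set" where
  "mesh_vertices \<T> = {p. \<exists>K\<in>\<T>. p extreme_point_of K}"

definition P1 :: "(real ^ 'd) set \<Rightarrow> (real ^ 'd \<Rightarrow> complex) set" where
  "P1 K = {u. \<exists>(c :: complex) (b :: complex ^ 'd).
             \<forall>x\<in>K. u x = c + (\<Sum>k\<in>UNIV. b $ k * of_real (x $ k))}"

text \<open>
  Elements are pointwise representatives, affine on every closed simplex; such a function is
  determined by its class in \<open>H\<^sup>1\<close> everywhere on \<open>closure \<Omega>\<close>. Values outside
  \<open>closure \<Omega>\<close> are irrelevant.
\<close>

definition fe_space ::
    "(real ^ 'd) set \<Rightarrow> (real ^ 'd) set set \<Rightarrow> (real ^ 'd \<Rightarrow> complex) set" where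
  "fe_space \<Omega> \<T> = {u \<in> H1 \<Omega>. \<forall>K\<in>\<T>. u \<in> P1 K}"

text \<open>\<open>N\<close> is the number of mesh vertices, and \<open>p\<close> an arbitrary enumeration of them from 0.\<close>

definition nodal_basis ::
    "(real ^ 'd) set \<Rightarrow> (real ^ 'd) set set \<Rightarrow> nat \<Rightarrow> (nat \<Rightarrow> real ^ 'd \<Rightarrow> real) \<Rightarrow> bool" where
  "nodal_basis \<Omega> \<T> N \<phi> \<longleftrightarrow>
     (\<exists>p. bij_betw p {..<N} (mesh_vertices \<T>) \<and>
        (\<forall>i<N. (\<lambda>x. complex_of_real (\<phi> i x)) \<in> fe_space \<Omega> \<T> \<and>
               (\<forall>j<N. \<phi> i (p j) = (if i = j then 1 else 0))))"

definition galerkin_matrix ::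
    "nat \<Rightarrow> (nat \<Rightarrow> real ^ 'd \<Rightarrow> real) \<Rightarrow>
     ((real ^ 'd \<Rightarrow> complex) \<Rightarrow> (real ^ 'd \<Rightarrow> complex) \<Rightarrow> complex) \<Rightarrow> complex mat" where
  "galerkin_matrix N \<phi> form =
     mat N N (\<lambda>(i, j). form (\<lambda>x. complex_of_real (\<phi> j x)) (\<lambda>x. complex_of_real (\<phi> i x)))"


section \<open>Norms and pseudospectra\<close>

definition euclid_norm :: "complex Matrix.vec \<Rightarrow> real" where
  "euclid_norm x = sqrt (\<Sum>i<dim_vec x. (cmod (vec_index x i))\<^sup>2)"

definition spectral_norm :: "complex mat \<Rightarrow> real" where
  "spectral_norm M = Sup {euclid_norm (M *\<^sub>v x) | x. x \<in> carrier_vec (dim_col M) \<and> euclid_norm x = 1}"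

definition mat_inv :: "complex mat \<Rightarrow> complex mat" where
  "mat_inv M = the (mat_inverse M)"

text \<open>The norm of the inverse, with value \<open>\<infinity>\<close> for singular matrices.\<close>

definition inverse_norm :: "complex mat \<Rightarrow> ereal" where
  "inverse_norm M = (case mat_inverse M of None \<Rightarrow> \<infinity> | Some R \<Rightarrow> ereal (spectral_norm R))"

definition pseudospectrum :: "real \<Rightarrow> complex mat \<Rightarrow> complex set" where
  "pseudospectrum \<epsilon> M =
     {z. inverse_norm (z \<cdot>\<^sub>m 1\<^sub>m (dim_row M) - M) \<ge> ereal (1 / \<epsilon>)}"

text \<open>\<open>x\<close> is the coefficient vector of \<open>u\<close>.\<close>

definition coeff_vec_of ::
    "(real ^ 'd) set \<Rightarrow> nat \<Rightarrow> (nat \<Rightarrow> real ^ 'd \<Rightarrow> real) \<Rightarrow>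
     (real ^ 'd \<Rightarrow> complex) \<Rightarrow> complex Matrix.vec \<Rightarrow> bool" where
  "coeff_vec_of \<Omega> N \<phi> u x \<longleftrightarrow>
     x \<in> carrier_vec N \<and>
     (\<forall>y\<in>closure \<Omega>. u y = (\<Sum>i<N. vec_index x i * complex_of_real (\<phi> i y)))"

definition norm_equivalence ::
    "(real ^ 'd) set \<Rightarrow> (real ^ 'd) set set \<Rightarrow> nat \<Rightarrow> (nat \<Rightarrow> real ^ 'd \<Rightarrow> real) \<Rightarrow>
     real \<Rightarrow> real \<Rightarrow> bool" where
  "norm_equivalence \<Omega> \<T> N \<phi> c1 C1 \<longleftrightarrow>
     (\<forall>u\<in>fe_space \<Omega> \<T>. \<forall>x. coeff_vec_of \<Omega> N \<phi> u x \<longrightarrow>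
        c1 * mesh_size \<T> powr (real CARD('d) / 2) * euclid_norm x \<le> L2_norm \<Omega> u \<and>
        L2_norm \<Omega> u \<le> C1 * mesh_size \<T> powr (real CARD('d) / 2) * euclid_norm x)"

end

theory Submission
  imports Defs "Jordan_Normal_Form.Determinant"
begin

text \<open>
  Let \<open>S\<close>, \<open>T\<close> and \<open>M\<close> be the Galerkin matrices of the gradient, boundary and \<open>L\<^sup>2\<close> inner products,
  so that \<open>A = S + i \<kappa> T - \<kappa>\<^sup>2 M\<close> and \<open>B = A + i \<sigma> M\<close>. All three are Gram matrices. Hence the
  form of \<open>A\<close> has nonnegative imaginary part \<open>\<kappa> x\<^sup>* T x\<close>, whatever the signs of its real part,
  and by the norm equivalence \<open>M\<close> lies between \<open>l I\<close> and \<open>L I\<close>, where \<open>l = c\<^sub>1\<^sup>2 h\<^sup>d\<close> and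
  \<open>L = C\<^sub>1\<^sup>2 h\<^sup>d\<close>.

  Since \<open>A = B - i \<sigma> M\<close>, the pencil \<open>z B - A\<close> equals \<open>(z - 1) (A + i \<sigma> \<omega> M)\<close> with
  \<open>\<omega> = z / (z - 1)\<close>. Outside the closed disc \<open>|z - 1/2| \<le> 1/2\<close> the number \<open>\<omega>\<close> has positive real
  part \<open>(|z|\<^sup>2 - Re z) / |z - 1|\<^sup>2\<close>. Taking the imaginary part of the form therefore gives
  \<open>|(z B - A)\<^sup>-\<^sup>1| \<le> |z - 1| / (\<sigma> l (|z|\<^sup>2 - Re z))\<close>. Inserted into
  \<open>(z I - A B\<^sup>-\<^sup>1)\<^sup>-\<^sup>1 = (I - i \<sigma> M (z B - A)\<^sup>-\<^sup>1) / (z - 1)\<close>, this bounds the norm of the resolvent by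
  \<open>1 / |1 - z| + (L / l) / (|z|\<^sup>2 - Re z)\<close>, which is \<open>inverse_norm_preconditioned_le\<close>. The quotient
  \<open>L / l = (C\<^sub>1 / c\<^sub>1)\<^sup>2\<close> depends neither on \<open>h\<close> nor on \<open>\<kappa>\<close>, \<open>\<sigma>\<close> and \<open>\<epsilon>\<close>.

  What remains is to justify that the three matrices are Gram matrices of square integrable
  functions (\<open>Gram_form\<close>). For \<open>S\<close> and \<open>M\<close> this is part of membership in \<open>H\<^sup>1\<close>. For \<open>T\<close> it requires
  that finite element functions are continuous on the boundary and that the boundary has finite
  Hausdorff measure of dimension \<open>d - 1\<close> (\<open>finite_measure_surface_measure\<close>). The latter is proved by
  covering: locally the boundary is a Lipschitz graph, whose covering numbers are controlled by a
  packing argument in \<open>d\<close>-dimensional volume (\<open>covering_content_bounded_projection\<close>). The norm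
  equivalence applies to functions of the finite element space, so this space also has to be closed
  under linear combinations (\<open>fe_space_sum\<close>).
\<close>

section \<open>Complex vectors with their Euclidean norm\<close>

lemma euclid_norm_L2_set: "euclid_norm x = L2_set (\<lambda>i. cmod (vec_index x i)) {..<dim_vec x}"
  by (simp add: euclid_norm_def L2_set_def)

lemma euclid_norm_nonneg [simp]: "0 \<le> euclid_norm x"
  by (simp add: euclid_norm_L2_set)

lemma euclid_norm_smult: "euclid_norm (a \<cdot>\<^sub>v x) = cmod a * euclid_norm x"
proof -
  have "L2_set (\<lambda>i. cmod (vec_index (a \<cdot>\<^sub>v x) i)) {..<dim_vec x}
      = L2_set (\<lambda>i. cmod a * cmod (vec_index x i)) {..<dim_vec x}"
    by (rule L2_set_cong) (auto simp: norm_mult)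
  then show ?thesis
    by (simp add: euclid_norm_L2_set L2_set_right_distrib)
qed

lemma euclid_norm_triangle:
  assumes "x \<in> carrier_vec n" "y \<in> carrier_vec n"
  shows "euclid_norm (x + y) \<le> euclid_norm x + euclid_norm y"
proof -
  have "euclid_norm (x + y) \<le> L2_set (\<lambda>i. cmod (vec_index x i) + cmod (vec_index y i)) {..<n}"
    unfolding euclid_norm_L2_set using assms
    by (auto intro!: L2_set_mono norm_triangle_ineq)
  also have "\<dots> \<le> euclid_norm x + euclid_norm y"
    unfolding euclid_norm_L2_set using assms
    by (metis L2_set_triangle_ineq carrier_vecD)
  finally show ?thesis .
qed

lemma cscalar_prod_sum:
  fixes x y :: "complex Matrix.vec"
  assumes "x \<in> carrier_vec n" "y \<in> carrier_vec n"
  shows "x \<bullet>c y = (\<Sum>i<n. vec_index x i * cnj (vec_index y i))"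
  using assms by (auto simp: scalar_prod_def lessThan_atLeast0 intro!: sum.cong)

lemma cscalar_prod_self:
  fixes x :: "complex Matrix.vec"
  shows "x \<bullet>c x = of_real ((euclid_norm x)\<^sup>2)"
proof -
  have "x \<in> carrier_vec (dim_vec x)" by simp
  then show ?thesis
    by (subst cscalar_prod_sum)
      (auto simp: euclid_norm_def sum_nonneg complex_norm_square simp flip: of_real_power
        intro!: sum.cong)
qed

lemma cscalar_prod_Cauchy_Schwarz:
  fixes x y :: "complex Matrix.vec"
  assumes "x \<in> carrier_vec n" "y \<in> carrier_vec n"
  shows "cmod (x \<bullet>c y) \<le> euclid_norm x * euclid_norm y"
proof -
  have "cmod (x \<bullet>c y) \<le> (\<Sum>i<n. \<bar>cmod (vec_index x i)\<bar> * \<bar>cmod (vec_index y i)\<bar>)"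
    unfolding cscalar_prod_sum[OF assms]
    by (rule order_trans[OF norm_sum]) (simp add: norm_mult)
  also have "\<dots> \<le> L2_set (\<lambda>i. cmod (vec_index x i)) {..<n} * L2_set (\<lambda>i. cmod (vec_index y i)) {..<n}"
    by (rule L2_set_mult_ineq)
  finally show ?thesis
    using assms by (simp add: euclid_norm_L2_set)
qed

lemma euclid_norm_eq_0_iff:
  assumes "x \<in> carrier_vec n"
  shows "euclid_norm x = 0 \<longleftrightarrow> x = 0\<^sub>v n"
  using conjugate_square_eq_0_vec[OF assms] by (simp add: cscalar_prod_self)

lemma cscalar_prod_add_left:
  fixes x y z :: "complex Matrix.vec"
  assumes "x \<in> carrier_vec n" "y \<in> carrier_vec n" "z \<in> carrier_vec n"
  shows "(x + y) \<bullet>c z = x \<bullet>c z + y \<bullet>c z"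
  using assms by (intro add_scalar_prod_distrib[of _ n]) auto

lemma cscalar_prod_smult_left:
  fixes x z :: "complex Matrix.vec"
  assumes "x \<in> carrier_vec n" "z \<in> carrier_vec n"
  shows "(a \<cdot>\<^sub>v x) \<bullet>c z = a * (x \<bullet>c z)"
  using assms by (intro smult_scalar_prod_distrib[of _ n]) auto

lemma cscalar_prod_commute:
  fixes x y :: "complex Matrix.vec"
  assumes "x \<in> carrier_vec n" "y \<in> carrier_vec n"
  shows "y \<bullet>c x = cnj (x \<bullet>c y)"
  using assms by (simp add: cscalar_prod_sum mult.commute)

lemma smult_mat_mult_vec:
  fixes M :: "complex mat"
  assumes "M \<in> carrier_mat m n" "x \<in> carrier_vec n"
  shows "(a \<cdot>\<^sub>m M) *\<^sub>v x = a \<cdot>\<^sub>v (M *\<^sub>v x)"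
  using assms by (intro eq_vecI) auto

section \<open>The norm of the inverse\<close>

text \<open>
  A square matrix that is bounded below has trivial kernel, so Gauss--Jordan elimination cannot
  fail on it.
\<close>

lemma mat_inverse_of_bounded_below:
  fixes Q :: "complex mat"
  assumes Q: "Q \<in> carrier_mat n n"
    and below: "\<And>x. x \<in> carrier_vec n \<Longrightarrow> euclid_norm x \<le> K * euclid_norm (Q *\<^sub>v x)"
  obtains R where "mat_inverse Q = Some R" "R \<in> carrier_mat n n" "Q * R = 1\<^sub>m n" "R * Q = 1\<^sub>m n"
proof -
  have "Determinant.det Q \<noteq> 0"
  proof
    assume "Determinant.det Q = 0"
    then obtain v where v: "v \<in> carrier_vec n" "v \<noteq> 0\<^sub>v n" "Q *\<^sub>v v = 0\<^sub>v n"
      using det_0_iff_vec_prod_zero[OF Q] by auto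
    have "euclid_norm (0\<^sub>v n :: complex Matrix.vec) = 0"
      using euclid_norm_eq_0_iff[of "0\<^sub>v n" n] by simp
    then have "euclid_norm v \<le> 0"
      using below[OF v(1)] v(3) by simp
    then show False
      using v euclid_norm_eq_0_iff[OF v(1)] euclid_norm_nonneg[of v] by linarith
  qed
  then have "mat_inverse Q \<noteq> None"
    using det_non_zero_imp_unit[OF Q, of n] mat_inverse(1)[OF Q, of n] by blast
  then show thesis
    using that mat_inverse(2)[OF Q] by blast
qed

text \<open>
  The spectral norm is a supremum over unit vectors in a type without a top element. It is a
  bound only because \<open>0 < n\<close> supplies a unit vector: the supremum of the empty set is
  unspecified.
\<close>

lemma inverse_norm_le:
  fixes Q :: "complex mat"
  assumes Q: "Q \<in> carrier_mat n n" and n: "0 < n"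
    and below: "\<And>x. x \<in> carrier_vec n \<Longrightarrow> euclid_norm x \<le> K * euclid_norm (Q *\<^sub>v x)"
  shows "inverse_norm Q \<le> ereal K"
proof -
  obtain R where R: "mat_inverse Q = Some R" "R \<in> carrier_mat n n" "Q * R = 1\<^sub>m n"
    using mat_inverse_of_bounded_below[OF Q below] by metis
  let ?S = "{euclid_norm (R *\<^sub>v x) | x. x \<in> carrier_vec (dim_col R) \<and> euclid_norm x = 1}"
  have "euclid_norm (unit_vec n 0 :: complex Matrix.vec) = 1"
  proof -
    have "(euclid_norm (unit_vec n 0 :: complex Matrix.vec))\<^sup>2
        = (\<Sum>i<n. (cmod (vec_index (unit_vec n 0) i))\<^sup>2)"
      by (simp add: euclid_norm_def sum_nonneg)
    also have "\<dots> = (\<Sum>i<n. if i = 0 then 1 else 0)"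
      by (rule sum.cong) (auto simp: unit_vec_def)
    also have "\<dots> = 1"
      using n by (subst sum.delta) auto
    finally have "\<bar>euclid_norm (unit_vec n 0 :: complex Matrix.vec)\<bar> = 1"
      by (simp add: abs_square_eq_1)
    then show ?thesis by simp
  qed
  moreover have "unit_vec n 0 \<in> carrier_vec (dim_col R)"
    using R(2) by auto
  ultimately have nonempty: "?S \<noteq> {}"
    by blast
  have "Sup ?S \<le> K"
  proof (rule cSup_least[OF nonempty])
    fix s assume "s \<in> ?S"
    then obtain x where x: "s = euclid_norm (R *\<^sub>v x)" "x \<in> carrier_vec n" "euclid_norm x = 1"
      using R(2) by auto
    have "Q *\<^sub>v (R *\<^sub>v x) = x"
      using assoc_mult_mat_vec[OF Q R(2) x(2)] R(3) x(2) by simp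
    then show "s \<le> K"
      using below[of "R *\<^sub>v x"] R(2) x by simp
  qed
  then show ?thesis
    by (simp add: inverse_norm_def R(1) spectral_norm_def)
qed

section \<open>The field of values and the preconditioned matrix\<close>

text \<open>
  This is the Cauchy--Schwarz inequality for the semi-inner product of \<open>M\<close>, applied to \<open>w\<close> and
  \<open>M w\<close>. It is obtained here by testing the nonnegativity of the form with the single vector
  \<open>L w - M w\<close>: among the vectors \<open>t w - M w\<close>, the choice \<open>t = L\<close> turns the resulting bound into
  \<open>L ((L |w|)\<^sup>2 - |M w|\<^sup>2)\<close>.
\<close>

lemma euclid_norm_mult_mat_vec_le:
  fixes M :: "complex mat"
  assumes M: "M \<in> carrier_mat n n"
    and herm: "\<And>x y. x \<in> carrier_vec n \<Longrightarrow> y \<in> carrier_vec n \<Longrightarrow> (M *\<^sub>v y) \<bullet>c x = cnj ((M *\<^sub>v x) \<bullet>c y)"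
    and nonneg: "\<And>x. x \<in> carrier_vec n \<Longrightarrow> 0 \<le> Re ((M *\<^sub>v x) \<bullet>c x)"
    and upper: "\<And>x. x \<in> carrier_vec n \<Longrightarrow> Re ((M *\<^sub>v x) \<bullet>c x) \<le> L * (euclid_norm x)\<^sup>2"
    and L: "0 < L" and w: "w \<in> carrier_vec n"
  shows "euclid_norm (M *\<^sub>v w) \<le> L * euclid_norm w"
proof -
  define v where "v = M *\<^sub>v w"
  have v: "v \<in> carrier_vec n" and Mv: "M *\<^sub>v v \<in> carrier_vec n"
    unfolding v_def using M w by auto
  let ?y = "of_real L \<cdot>\<^sub>v w + (-1) \<cdot>\<^sub>v v"
  have y: "?y \<in> carrier_vec n" using v w by simp
  have My: "M *\<^sub>v ?y = of_real L \<cdot>\<^sub>v v + (-1) \<cdot>\<^sub>v (M *\<^sub>v v)"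
    using M v w by (simp add: mult_add_distrib_mat_vec[of _ n n] mult_mat_vec v_def)
  have vv: "v \<bullet>c v = of_real ((euclid_norm v)\<^sup>2)" by (rule cscalar_prod_self)
  have Mvw: "(M *\<^sub>v v) \<bullet>c w = of_real ((euclid_norm v)\<^sup>2)"
    using herm[OF w v] vv by (simp add: v_def)
  have swap: "z \<bullet>c ?y = L * (z \<bullet>c w) - z \<bullet>c v" if z: "z \<in> carrier_vec n" for z
    using z v w by (simp add: cscalar_prod_commute[OF y z] cscalar_prod_add_left[of _ n]
        cscalar_prod_smult_left[of _ n] cscalar_prod_commute[of w n z] cscalar_prod_commute[of v n z])
  have form: "(M *\<^sub>v ?y) \<bullet>c ?y
      = L * (L * (v \<bullet>c w) - v \<bullet>c v) - (L * ((M *\<^sub>v v) \<bullet>c w) - (M *\<^sub>v v) \<bullet>c v)"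
    unfolding My using v Mv y w
    by (simp add: cscalar_prod_add_left[of _ n] cscalar_prod_smult_left[of _ n] swap algebra_simps)
  have "Re ((M *\<^sub>v ?y) \<bullet>c ?y)
      = L\<^sup>2 * Re ((M *\<^sub>v w) \<bullet>c w) - 2 * L * (euclid_norm v)\<^sup>2 + Re ((M *\<^sub>v v) \<bullet>c v)"
    unfolding form vv Mvw v_def[symmetric]
    by (simp add: power2_eq_square algebra_simps)
  also have "\<dots> \<le> L\<^sup>2 * (L * (euclid_norm w)\<^sup>2) - 2 * L * (euclid_norm v)\<^sup>2 + L * (euclid_norm v)\<^sup>2"
    using upper[OF w] upper[OF v] L by (intro add_mono diff_mono mult_left_mono) auto
  also have "\<dots> = L * ((L * euclid_norm w)\<^sup>2 - (euclid_norm v)\<^sup>2)"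
    by (simp add: power2_eq_square algebra_simps)
  finally have "0 \<le> (L * euclid_norm w)\<^sup>2 - (euclid_norm v)\<^sup>2"
    using nonneg[OF y] L by (metis order_trans zero_le_mult_iff not_less)
  then have "(euclid_norm v)\<^sup>2 \<le> (L * euclid_norm w)\<^sup>2"
    by (simp only: diff_ge_0_iff_ge)
  then show ?thesis
    unfolding v_def by (rule power2_le_imp_le) (use L in simp)
qed

text \<open>
  The heart of the argument, free of any finite elements. With \<open>\<omega> = z / (z - 1)\<close>,
  \<open>z B - A = (z - 1) (A + i \<sigma> \<omega> M)\<close>. The imaginary part of the form of the bracket is at
  least \<open>\<sigma> Re \<omega> l |w|\<^sup>2\<close>, which bounds the bracket below as soon as \<open>Re \<omega> > 0\<close>, and
  \<open>Re \<omega> = (|z|\<^sup>2 - Re z) / |z - 1|\<^sup>2\<close>. Finally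
  \<open>(z I - A B\<^sup>-\<^sup>1)\<^sup>-\<^sup>1 = B (z B - A)\<^sup>-\<^sup>1 = (I - i \<sigma> M (z B - A)\<^sup>-\<^sup>1) / (z - 1)\<close>: the matrix
  \<open>A\<close>, on whose norm there is no control, has cancelled, \<open>|M| \<le> L\<close>, and \<open>\<sigma>\<close> drops out.
\<close>

lemma inverse_norm_preconditioned_le:
  fixes A B M :: "complex mat"
  assumes A: "A \<in> carrier_mat n n" and M: "M \<in> carrier_mat n n" and n: "0 < n"
    and herm: "\<And>x y. x \<in> carrier_vec n \<Longrightarrow> y \<in> carrier_vec n \<Longrightarrow> (M *\<^sub>v y) \<bullet>c x = cnj ((M *\<^sub>v x) \<bullet>c y)"
    and lower: "\<And>x. x \<in> carrier_vec n \<Longrightarrow> l * (euclid_norm x)\<^sup>2 \<le> Re ((M *\<^sub>v x) \<bullet>c x)"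
    and upper: "\<And>x. x \<in> carrier_vec n \<Longrightarrow> Re ((M *\<^sub>v x) \<bullet>c x) \<le> L * (euclid_norm x)\<^sup>2"
    and ImA: "\<And>x. x \<in> carrier_vec n \<Longrightarrow> 0 \<le> Im ((A *\<^sub>v x) \<bullet>c x)"
    and l: "0 < l" and L: "0 < L" and \<sigma>: "0 < \<sigma>"
    and B: "B = A + (\<i> * of_real \<sigma>) \<cdot>\<^sub>m M"
    and z: "Re z < (cmod z)\<^sup>2"
  shows "inverse_norm (z \<cdot>\<^sub>m 1\<^sub>m n - A * mat_inv B)
    \<le> ereal (1 / cmod (1 - z) + (L / l) / ((cmod z)\<^sup>2 - Re z))"
proof -
  have Bc: "B \<in> carrier_mat n n" using A M B by simp
  have Bv: "B *\<^sub>v w = A *\<^sub>v w + (\<i> * of_real \<sigma>) \<cdot>\<^sub>v (M *\<^sub>v w)" if "w \<in> carrier_vec n" for w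
    unfolding B using A M that
    by (simp add: add_mult_distrib_mat_vec[of _ n n] smult_mat_mult_vec[of _ n n])
  have real: "Im ((M *\<^sub>v w) \<bullet>c w) = 0" if "w \<in> carrier_vec n" for w
    using herm[OF that that] by (metis Reals_cnj_iff complex_is_Real_iff)
  have nonneg: "0 \<le> Re ((M *\<^sub>v w) \<bullet>c w)" if "w \<in> carrier_vec n" for w
    using lower[OF that] l by (intro order_trans[OF _ lower[OF that]]) simp
  have field: "\<sigma> * Re \<omega> * l * euclid_norm w \<le> euclid_norm (A *\<^sub>v w + (\<i> * of_real \<sigma> * \<omega>) \<cdot>\<^sub>v (M *\<^sub>v w))"
    if w: "w \<in> carrier_vec n" and \<omega>: "0 \<le> Re \<omega>" for \<omega> w
  proof -
    let ?q = "A *\<^sub>v w + (\<i> * of_real \<sigma> * \<omega>) \<cdot>\<^sub>v (M *\<^sub>v w)"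
    have Aw: "A *\<^sub>v w \<in> carrier_vec n" and Mw: "M *\<^sub>v w \<in> carrier_vec n"
      using A M w by auto
    have "\<sigma> * Re \<omega> * (l * (euclid_norm w)\<^sup>2) \<le> \<sigma> * Re \<omega> * Re ((M *\<^sub>v w) \<bullet>c w)"
      using lower[OF w] \<omega> \<sigma> by (intro mult_left_mono) auto
    also have "\<dots> \<le> Im (?q \<bullet>c w)"
      using ImA[OF w] Aw Mw w real[OF w]
      by (simp add: cscalar_prod_add_left[of _ n] cscalar_prod_smult_left[of _ n])
    also have "\<dots> \<le> cmod (?q \<bullet>c w)"
      using abs_Im_le_cmod by (rule order_trans[OF abs_ge_self])
    also have "\<dots> \<le> euclid_norm ?q * euclid_norm w"
      using Aw Mw w by (intro cscalar_prod_Cauchy_Schwarz) auto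
    finally have *: "(\<sigma> * Re \<omega> * l * euclid_norm w) * euclid_norm w \<le> euclid_norm ?q * euclid_norm w"
      by (simp add: power2_eq_square mult.assoc)
    show ?thesis
    proof (cases "euclid_norm w = 0")
      case False
      then have "0 < euclid_norm w" using euclid_norm_nonneg[of w] by linarith
      with * show ?thesis by simp
    qed simp
  qed
  \<comment> \<open>\<open>B\<close> is the bracket with \<open>\<omega> = 1\<close>, so the same estimate makes it invertible.\<close>
  have "euclid_norm w \<le> (1 / (\<sigma> * l)) * euclid_norm (B *\<^sub>v w)" if "w \<in> carrier_vec n" for w
    using field[of w 1] that \<sigma> l by (simp add: Bv pos_le_divide_eq mult.commute mult.left_commute)
  then obtain R where R: "mat_inverse B = Some R" "R \<in> carrier_mat n n" "B * R = 1\<^sub>m n"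
    using mat_inverse_of_bounded_below[OF Bc] by metis
  define D where "D = (cmod z)\<^sup>2 - Re z"
  have D: "0 < D" using z by (simp add: D_def)
  have z1: "z \<noteq> 1" using z by auto
  define \<omega> where "\<omega> = z / (z - 1)"
  have Re_\<omega>: "Re \<omega> = D / (cmod (1 - z))\<^sup>2"
  proof -
    have "(cmod (1 - z))\<^sup>2 = (Re z - 1)\<^sup>2 + (Im z)\<^sup>2"
      by (simp add: cmod_power2 power2_commute)
    then show ?thesis
      by (simp add: \<omega>_def D_def Re_divide cmod_power2) (simp add: power2_eq_square algebra_simps)
  qed
  have resolvent_split: "p + \<i> * of_real \<sigma> * q
      = ((z - 1) * (p + \<i> * of_real \<sigma> * \<omega> * q) - \<i> * of_real \<sigma> * q) / (z - 1)" for p q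
  proof -
    define d where "d = z - 1"
    then have "d \<noteq> 0" "z = d + 1" using z1 by auto
    then show ?thesis by (simp add: \<omega>_def field_simps)
  qed
  define r where "r = cmod (1 - z)"
  have r: "0 < r" using z1 by (simp add: r_def)
  let ?Q = "z \<cdot>\<^sub>m 1\<^sub>m n - A * mat_inv B"
  have Q: "?Q \<in> carrier_mat n n" using A R by (simp add: mat_inv_def minus_carrier_mat[OF mult_carrier_mat[of _ _ n]])
  show ?thesis
  proof (rule inverse_norm_le[OF Q n])
    fix y :: "complex Matrix.vec"
    assume y: "y \<in> carrier_vec n"
    \<comment> \<open>With \<open>y = B w\<close> the equation \<open>(z I - A B\<^sup>-\<^sup>1) y = x\<close> becomes \<open>(z B - A) w = x\<close>.\<close>
    define w where "w = R *\<^sub>v y"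
    have w: "w \<in> carrier_vec n" using R y by (simp add: w_def)
    define a where "a = A *\<^sub>v w"
    define m where "m = M *\<^sub>v w"
    have a: "a \<in> carrier_vec n" and m: "m \<in> carrier_vec n"
      using A M w by (auto simp: a_def m_def)
    have yB: "y = a + (\<i> * of_real \<sigma>) \<cdot>\<^sub>v m"
      using assoc_mult_mat_vec[OF Bc R(2) y] R(3) y Bv[OF w] by (simp add: w_def a_def m_def)
    define x where "x = ?Q *\<^sub>v y"
    have "x = z \<cdot>\<^sub>v y - a"
      unfolding x_def a_def w_def using A R y
      by (simp add: mat_inv_def minus_mult_distrib_mat_vec[of _ n n] assoc_mult_mat_vec[of _ n n _ n]
          smult_mat_mult_vec[of _ n n])
    also have "\<dots> = (z - 1) \<cdot>\<^sub>v (a + (\<i> * of_real \<sigma> * \<omega>) \<cdot>\<^sub>v m)"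
      unfolding yB using a m z1 by (intro eq_vecI) (auto simp: \<omega>_def field_simps)
    finally have x: "x = (z - 1) \<cdot>\<^sub>v (a + (\<i> * of_real \<sigma> * \<omega>) \<cdot>\<^sub>v m)" .
    have xc: "x \<in> carrier_vec n" using a m by (simp add: x)
    have "r * (\<sigma> * Re \<omega> * l * euclid_norm w) \<le> euclid_norm x"
      unfolding x euclid_norm_smult r_def
      using field[OF w, of \<omega>, folded a_def m_def] D
      by (auto simp: Re_\<omega> norm_minus_commute
          simp del: times_divide_eq_right times_divide_eq_left intro!: mult_left_mono)
    then have w_le: "\<sigma> * euclid_norm w \<le> r / (D * l) * euclid_norm x"
      using D r l by (simp add: Re_\<omega> r_def[symmetric] field_simps power2_eq_square)
    have "y = (1 / (z - 1)) \<cdot>\<^sub>v (x + (- (\<i> * of_real \<sigma>)) \<cdot>\<^sub>v m)"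
      unfolding x yB using a m by (intro eq_vecI) (auto simp: resolvent_split)
    then have "euclid_norm y = 1 / r * euclid_norm (x + (- (\<i> * of_real \<sigma>)) \<cdot>\<^sub>v m)"
      by (simp add: euclid_norm_smult norm_divide r_def norm_minus_commute)
    also have "\<dots> \<le> 1 / r * (euclid_norm x + \<sigma> * (L * euclid_norm w))"
    proof -
      have "euclid_norm m \<le> L * euclid_norm w"
        unfolding m_def by (rule euclid_norm_mult_mat_vec_le[OF M herm nonneg upper L w])
      then have "\<sigma> * euclid_norm m \<le> \<sigma> * (L * euclid_norm w)"
        by (rule mult_left_mono) (use \<sigma> in simp)
      moreover have "euclid_norm (x + (- (\<i> * of_real \<sigma>)) \<cdot>\<^sub>v m) \<le> euclid_norm x + \<sigma> * euclid_norm m"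
        using euclid_norm_triangle[OF xc, of "(- (\<i> * of_real \<sigma>)) \<cdot>\<^sub>v m"] m \<sigma>
        by (simp add: euclid_norm_smult norm_mult)
      ultimately have "euclid_norm (x + (- (\<i> * of_real \<sigma>)) \<cdot>\<^sub>v m) \<le> euclid_norm x + \<sigma> * (L * euclid_norm w)"
        by linarith
      then show ?thesis using r by (intro mult_left_mono) auto
    qed
    also have "\<dots> \<le> 1 / r * (euclid_norm x + L * (r / (D * l) * euclid_norm x))"
    proof (intro mult_left_mono add_left_mono)
      show "\<sigma> * (L * euclid_norm w) \<le> L * (r / (D * l) * euclid_norm x)"
        unfolding mult.left_commute[of \<sigma>] using w_le by (rule mult_left_mono) (use L in simp)
    qed (use r in simp)
    also have "\<dots> = (1 / r + (L / l) / D) * euclid_norm x"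
      using r D l by (simp add: field_simps)
    finally show "euclid_norm y \<le> (1 / cmod (1 - z) + L / l / ((cmod z)\<^sup>2 - Re z)) * euclid_norm (?Q *\<^sub>v y)"
      unfolding x_def r_def D_def .
  qed
qed

section \<open>Gram matrices of square integrable functions\<close>

definition square_integrable :: "'a measure \<Rightarrow> ('a \<Rightarrow> complex) \<Rightarrow> bool" where
  "square_integrable \<mu> u \<longleftrightarrow> u \<in> borel_measurable \<mu> \<and> integrable \<mu> (\<lambda>x. (cmod (u x))\<^sup>2)"

lemma square_integrable_mult_cnj:
  assumes "square_integrable \<mu> u" "square_integrable \<mu> v"
  shows "integrable \<mu> (\<lambda>x. u x * cnj (v x))"
proof (rule Bochner_Integration.integrable_bound)
  show "integrable \<mu> (\<lambda>x. (cmod (u x))\<^sup>2 + (cmod (v x))\<^sup>2)"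
    using assms by (auto simp: square_integrable_def)
  have [measurable]: "u \<in> borel_measurable \<mu>" "v \<in> borel_measurable \<mu>"
    using assms by (auto simp: square_integrable_def)
  have "(\<lambda>x. cnj (v x)) \<in> borel_measurable \<mu>"
    by (intro borel_measurable_continuous_on[of cnj] continuous_intros) auto
  then show "(\<lambda>x. u x * cnj (v x)) \<in> borel_measurable \<mu>"
    by measurable
  have "cmod (u x * cnj (v x)) \<le> (cmod (u x))\<^sup>2 + (cmod (v x))\<^sup>2" for x
    using sum_squares_bound[of "cmod (u x)" "cmod (v x)"]
      mult_nonneg_nonneg[OF norm_ge_zero norm_ge_zero, of "u x" "v x"]
    unfolding norm_mult complex_mod_cnj by linarith
  then show "AE x in \<mu>. norm (u x * cnj (v x)) \<le> norm ((cmod (u x))\<^sup>2 + (cmod (v x))\<^sup>2)"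
    by simp
qed

lemma square_integrable_sum:
  assumes "\<And>j. j \<in> J \<Longrightarrow> square_integrable \<mu> (f j)"
  shows "square_integrable \<mu> (\<lambda>x. \<Sum>j\<in>J. c j * f j x)"
proof -
  have "integrable \<mu> (\<lambda>x. c i * cnj (c j) * (f i x * cnj (f j x)))" if "i \<in> J" "j \<in> J" for i j
    using that by (intro integrable_mult_right square_integrable_mult_cnj assms)
  then have "integrable \<mu> (\<lambda>x. \<Sum>i\<in>J. \<Sum>j\<in>J. c i * cnj (c j) * (f i x * cnj (f j x)))"
    by (intro Bochner_Integration.integrable_sum)
  also have "(\<lambda>x. \<Sum>i\<in>J. \<Sum>j\<in>J. c i * cnj (c j) * (f i x * cnj (f j x)))
      = (\<lambda>x. of_real ((cmod (\<Sum>j\<in>J. c j * f j x))\<^sup>2))"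
    by (simp only: complex_norm_square) (simp add: sum_product algebra_simps)
  finally have "integrable \<mu> (\<lambda>x. (cmod (\<Sum>j\<in>J. c j * f j x))\<^sup>2)"
    by (auto dest: integrable_Re simp del: of_real_power)
  moreover have "(\<lambda>x. \<Sum>j\<in>J. c j * f j x) \<in> borel_measurable \<mu>"
    using assms by (intro borel_measurable_sum borel_measurable_times) (auto simp: square_integrable_def)
  ultimately show ?thesis
    by (simp add: square_integrable_def)
qed

text \<open>
  Square integrability is essential: an integral that does not converge is \<open>0\<close> by convention, and a
  Gram matrix with some entries replaced by \<open>0\<close> need not be positive semidefinite.
\<close>

lemma Gram_form:
  assumes "\<And>j. j \<in> J \<Longrightarrow> square_integrable \<mu> (f j)"
  shows "(\<Sum>i\<in>J. \<Sum>j\<in>J. (\<integral>x. f j x * cnj (f i x) \<partial>\<mu>) * c j * cnj (c i))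
    = of_real (\<integral>x. (cmod (\<Sum>j\<in>J. c j * f j x))\<^sup>2 \<partial>\<mu>)"
proof -
  have int: "integrable \<mu> (\<lambda>x. f j x * cnj (f i x) * (c j * cnj (c i)))" if "i \<in> J" "j \<in> J" for i j
    using that by (intro integrable_mult_left square_integrable_mult_cnj assms)
  have "(\<Sum>i\<in>J. \<Sum>j\<in>J. (\<integral>x. f j x * cnj (f i x) \<partial>\<mu>) * c j * cnj (c i))
    = (\<Sum>i\<in>J. \<Sum>j\<in>J. \<integral>x. f j x * cnj (f i x) * (c j * cnj (c i)) \<partial>\<mu>)"
    by (simp only: integral_mult_left_zero) (simp only: mult.assoc)
  also have "\<dots> = (\<integral>x. (\<Sum>i\<in>J. \<Sum>j\<in>J. f j x * cnj (f i x) * (c j * cnj (c i))) \<partial>\<mu>)"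
    using int by (simp add: Bochner_Integration.integral_sum Bochner_Integration.integrable_sum)
  also have "\<dots> = (\<integral>x. of_real ((cmod (\<Sum>j\<in>J. c j * f j x))\<^sup>2) \<partial>\<mu>)"
    unfolding complex_norm_square
    by (auto simp: sum_product algebra_simps intro!: Bochner_Integration.integral_cong sum.swap)
  finally show ?thesis by (simp del: of_real_power)
qed

section \<open>The quadratic forms of the Galerkin matrices\<close>

lemma galerkin_matrix_carrier [simp]: "galerkin_matrix N \<phi> form \<in> carrier_mat N N"
  by (simp add: galerkin_matrix_def)

lemma galerkin_matrix_form:
  assumes "x \<in> carrier_vec N" "y \<in> carrier_vec N"
  shows "(galerkin_matrix N \<phi> form *\<^sub>v x) \<bullet>c y
    = (\<Sum>i<N. \<Sum>j<N. form (\<lambda>p. of_real (\<phi> j p)) (\<lambda>p. of_real (\<phi> i p))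
          * vec_index x j * cnj (vec_index y i))"
  using assms
  by (auto simp: scalar_prod_def galerkin_matrix_def lessThan_atLeast0 sum_distrib_right
      intro!: sum.cong)

lemma galerkin_matrix_shifted:
  "galerkin_matrix N \<phi> (shifted_form \<Omega> \<kappa> \<sigma>)
    = galerkin_matrix N \<phi> (helmholtz_form \<Omega> \<kappa>)
      + (\<i> * of_real \<sigma>) \<cdot>\<^sub>m galerkin_matrix N \<phi> (L2_inner \<Omega>)"
  by (rule eq_matI) (auto simp: galerkin_matrix_def shifted_form_def)

lemma galerkin_helmholtz_form:
  assumes "x \<in> carrier_vec N" "y \<in> carrier_vec N"
  shows "(galerkin_matrix N \<phi> (helmholtz_form \<Omega> \<kappa>) *\<^sub>v x) \<bullet>c y
    = (galerkin_matrix N \<phi> (grad_inner \<Omega>) *\<^sub>v x) \<bullet>c y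
      + \<i> * of_real \<kappa> * ((galerkin_matrix N \<phi> (bdry_inner \<Omega>) *\<^sub>v x) \<bullet>c y)
      - of_real (\<kappa>\<^sup>2) * ((galerkin_matrix N \<phi> (L2_inner \<Omega>) *\<^sub>v x) \<bullet>c y)"
  unfolding galerkin_matrix_form[OF assms] helmholtz_form_def
  by (simp add: sum_distrib_left sum.distrib sum_subtractf algebra_simps)

lemma galerkin_L2_hermitian:
  assumes "x \<in> carrier_vec N" "y \<in> carrier_vec N"
  shows "(galerkin_matrix N \<phi> (L2_inner \<Omega>) *\<^sub>v y) \<bullet>c x
    = cnj ((galerkin_matrix N \<phi> (L2_inner \<Omega>) *\<^sub>v x) \<bullet>c y)"
proof -
  have "cnj (L2_inner \<Omega> u v) = L2_inner \<Omega> v u" for u v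
    unfolding L2_inner_def
    by (simp add: mult.commute flip: Bochner_Integration.integral_cnj)
  then show ?thesis
    unfolding galerkin_matrix_form[OF assms] galerkin_matrix_form[OF assms(2,1)]
    by (subst sum.swap) (simp add: algebra_simps)
qed

lemma L2_iff_square_integrable: "u \<in> L2 \<Omega> \<longleftrightarrow> square_integrable (lebesgue_on \<Omega>) u"
  by (simp add: L2_def square_integrable_def)

lemma has_weak_gradient_weak_gradient: "u \<in> H1 \<Omega> \<Longrightarrow> has_weak_gradient \<Omega> u (weak_gradient \<Omega> u)"
  unfolding H1_def weak_gradient_def by (auto intro: someI_ex[of "has_weak_gradient \<Omega> u"])

text \<open>
  Weak gradients enter through an arbitrary choice, made separately for every basis function.
  Whatever the choices, the components in a fixed direction \<open>k\<close> are square integrable, and the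
  matrix is the sum over \<open>k\<close> of their Gram matrices. Its form is real, so it contributes nothing to
  the imaginary part of the form of \<open>A\<close>.
\<close>

lemma galerkin_grad_real:
  assumes \<phi>: "\<And>i. i < N \<Longrightarrow> (\<lambda>p. complex_of_real (\<phi> i p)) \<in> H1 \<Omega>"
    and x: "x \<in> carrier_vec N"
  shows "(galerkin_matrix N \<phi> (grad_inner \<Omega>) *\<^sub>v x) \<bullet>c x \<in> \<real>"
proof -
  define g where "g i = weak_gradient \<Omega> (\<lambda>p. complex_of_real (\<phi> i p))" for i
  have g: "square_integrable (lebesgue_on \<Omega>) (\<lambda>p. g i p $ k)" if "i < N" for i k
    using has_weak_gradient_weak_gradient[OF \<phi>[OF that]]
    by (simp add: g_def has_weak_gradient_def L2_iff_square_integrable)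
  have split: "grad_inner \<Omega> (\<lambda>p. of_real (\<phi> j p)) (\<lambda>p. of_real (\<phi> i p))
      = (\<Sum>k\<in>UNIV. \<integral>p. g j p $ k * cnj (g i p $ k) \<partial>lebesgue_on \<Omega>)" if "i < N" "j < N" for i j
    using that unfolding grad_inner_def g_def[symmetric]
    by (intro Bochner_Integration.integral_sum square_integrable_mult_cnj g)
  have "(galerkin_matrix N \<phi> (grad_inner \<Omega>) *\<^sub>v x) \<bullet>c x
    = (\<Sum>i<N. \<Sum>j<N. \<Sum>k\<in>UNIV. (\<integral>p. g j p $ k * cnj (g i p $ k) \<partial>lebesgue_on \<Omega>)
          * vec_index x j * cnj (vec_index x i))"
    unfolding galerkin_matrix_form[OF x x] by (simp add: split sum_distrib_right)
  also have "\<dots> = (\<Sum>k\<in>UNIV. \<Sum>i<N. \<Sum>j<N. (\<integral>p. g j p $ k * cnj (g i p $ k) \<partial>lebesgue_on \<Omega>)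
          * vec_index x j * cnj (vec_index x i))"
    by (subst sum.swap[of _ _ UNIV]) (simp add: sum.swap[of _ _ UNIV])
  also have "\<dots> = (\<Sum>k\<in>UNIV. of_real (\<integral>p. (cmod (\<Sum>j<N. vec_index x j * g j p $ k))\<^sup>2 \<partial>lebesgue_on \<Omega>))"
    using g by (intro sum.cong refl Gram_form) auto
  finally show ?thesis
    by (simp flip: of_real_sum)
qed

lemma galerkin_bdry_nonneg:
  assumes \<phi>: "\<And>i. i < N \<Longrightarrow> square_integrable (surface_measure \<Omega>) (\<lambda>p. complex_of_real (\<phi> i p))"
    and x: "x \<in> carrier_vec N"
  shows "0 \<le> Re ((galerkin_matrix N \<phi> (bdry_inner \<Omega>) *\<^sub>v x) \<bullet>c x)"
  unfolding galerkin_matrix_form[OF x x] bdry_inner_def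
  using \<phi> by (subst Gram_form) auto

lemma galerkin_L2_form:
  assumes \<phi>: "\<And>i. i < N \<Longrightarrow> (\<lambda>p. complex_of_real (\<phi> i p)) \<in> L2 \<Omega>"
    and x: "x \<in> carrier_vec N"
  shows "(galerkin_matrix N \<phi> (L2_inner \<Omega>) *\<^sub>v x) \<bullet>c x
    = of_real ((L2_norm \<Omega> (\<lambda>p. \<Sum>j<N. vec_index x j * of_real (\<phi> j p)))\<^sup>2)"
  unfolding galerkin_matrix_form[OF x x] L2_inner_def L2_norm_def
  using \<phi> by (subst Gram_form) (auto simp: L2_iff_square_integrable simp flip: of_real_power)

section \<open>The finite element space\<close>

lemma test_function_pderivative_continuous:
  assumes "\<psi> \<in> test_functions \<Omega>"
  shows "continuous_on UNIV (pderivative k \<psi>)"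
proof -
  have "Ck (Suc 0) \<psi>" using assms by (auto simp: test_functions_def simp del: Ck.simps)
  then show ?thesis by simp
qed

lemma test_function_continuous:
  assumes "\<psi> \<in> test_functions \<Omega>"
  shows "continuous_on UNIV \<psi>"
proof -
  have "Ck 0 \<psi>" using assms by (auto simp: test_functions_def simp del: Ck.simps)
  then show ?thesis by simp
qed

lemma finite_measure_lebesgue_on:
  fixes \<Omega> :: "'a::euclidean_space set"
  assumes "open \<Omega>" "bounded \<Omega>"
  shows "finite_measure (lebesgue_on \<Omega>)"
  using assms bounded_set_imp_lmeasurable[of \<Omega>]
  by (intro finite_measureI) (auto simp: emeasure_restrict_space lmeasurable_iff_integrable fmeasurable_def)

text \<open>
  On a finite measure space bounded functions are square integrable.
\<close>

lemma square_integrable_bounded_mult: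
  assumes "finite_measure \<mu>" and u: "square_integrable \<mu> u"
    and h: "h \<in> borel_measurable \<mu>" and bound: "\<And>x. x \<in> space \<mu> \<Longrightarrow> \<bar>h x\<bar> \<le> b"
  shows "integrable \<mu> (\<lambda>x. u x * complex_of_real (h x))"
proof -
  interpret finite_measure \<mu> by fact
  have "(\<lambda>x. (h x)\<^sup>2) \<in> borel_measurable \<mu>" using h by measurable
  moreover have "\<bar>(h x)\<^sup>2\<bar> \<le> b\<^sup>2" if "x \<in> space \<mu>" for x
    using bound[OF that] by (simp add: abs_le_square_iff[symmetric])
  ultimately have "integrable \<mu> (\<lambda>x. (h x)\<^sup>2)"
    by (intro integrable_const_bound[of _ "b\<^sup>2"] AE_I2) auto
  then have "square_integrable \<mu> (\<lambda>x. of_real (h x))"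
    using h by (auto simp: square_integrable_def)
  from square_integrable_mult_cnj[OF u this] show ?thesis by simp
qed

lemma integrable_times_continuous:
  fixes \<Omega> :: "(real ^ 'd) set"
  assumes \<Omega>: "open \<Omega>" "bounded \<Omega>" and u: "u \<in> L2 \<Omega>" and h: "continuous_on UNIV h"
  shows "integrable (lebesgue_on \<Omega>) (\<lambda>x. u x * complex_of_real (h x))"
proof -
  have "compact (h ` closure \<Omega>)"
    using \<Omega> h by (meson compact_closure compact_continuous_image continuous_on_subset subset_UNIV)
  then obtain b where "\<And>x. x \<in> closure \<Omega> \<Longrightarrow> \<bar>h x\<bar> \<le> b"
    by (metis bounded_real compact_imp_bounded imageI)
  moreover have "h \<in> borel_measurable (lebesgue_on \<Omega>)"
    using h \<Omega> by (intro continuous_imp_measurable_on_sets_lebesgue) (auto intro: continuous_on_subset)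
  ultimately show ?thesis
    using finite_measure_lebesgue_on[OF \<Omega>] u closure_subset[of \<Omega>]
    by (intro square_integrable_bounded_mult[where b = b])
       (auto simp: L2_iff_square_integrable)
qed

text \<open>
  The defining identity of the weak gradient is linear in the function, but the integrals may be
  interchanged with the sum only because each of them converges: test functions and their
  derivatives are bounded on the bounded set \<open>\<Omega>\<close>.
\<close>

lemma H1_sum:
  fixes \<Omega> :: "(real ^ 'd) set"
  assumes \<Omega>: "open \<Omega>" "bounded \<Omega>" and f: "\<And>j. j \<in> J \<Longrightarrow> f j \<in> H1 \<Omega>"
  shows "(\<lambda>x. \<Sum>j\<in>J. c j * f j x) \<in> H1 \<Omega>"
proof -
  define g where "g j = weak_gradient \<Omega> (f j)" for j
  have g: "has_weak_gradient \<Omega> (f j) (g j)" if "j \<in> J" for j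
    using has_weak_gradient_weak_gradient[OF f[OF that]] by (simp add: g_def)
  have fL2: "f j \<in> L2 \<Omega>" if "j \<in> J" for j
    using f[OF that] by (simp add: H1_def)
  have gL2: "(\<lambda>x. g j x $ k) \<in> L2 \<Omega>" if "j \<in> J" for j k
    using g[OF that] by (simp add: has_weak_gradient_def)
  let ?u = "\<lambda>x. \<Sum>j\<in>J. c j * f j x" and ?g = "\<lambda>x. \<chi> k. \<Sum>j\<in>J. c j * g j x $ k"
  have "has_weak_gradient \<Omega> ?u ?g"
    unfolding has_weak_gradient_def
  proof (intro allI conjI ballI)
    fix k
    show "(\<lambda>x. ?g x $ k) \<in> L2 \<Omega>"
      using gL2 by (simp add: L2_iff_square_integrable square_integrable_sum)
    fix \<psi> :: "real ^ 'd \<Rightarrow> real" assume \<psi>: "\<psi> \<in> test_functions \<Omega>"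
    have "(\<integral>x. ?u x * of_real (pderivative k \<psi> x) \<partial>lebesgue_on \<Omega>)
        = (\<integral>x. (\<Sum>j\<in>J. c j * (f j x * of_real (pderivative k \<psi> x))) \<partial>lebesgue_on \<Omega>)"
      by (simp add: sum_distrib_right mult.assoc)
    also have "\<dots> = (\<Sum>j\<in>J. c j * (\<integral>x. f j x * of_real (pderivative k \<psi> x) \<partial>lebesgue_on \<Omega>))"
      using fL2 test_function_pderivative_continuous[OF \<psi>] \<Omega>
      by (simp add: Bochner_Integration.integral_sum integrable_times_continuous)
    also have "\<dots> = (\<Sum>j\<in>J. c j * - (\<integral>x. g j x $ k * of_real (\<psi> x) \<partial>lebesgue_on \<Omega>))"
      using g \<psi> by (simp add: has_weak_gradient_def)
    also have "\<dots> = - (\<integral>x. (\<Sum>j\<in>J. c j * (g j x $ k * of_real (\<psi> x))) \<partial>lebesgue_on \<Omega>)"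
      using gL2 test_function_continuous[OF \<psi>] \<Omega>
      by (simp add: Bochner_Integration.integral_sum integrable_times_continuous sum_negf)
    also have "\<dots> = - (\<integral>x. ?g x $ k * of_real (\<psi> x) \<partial>lebesgue_on \<Omega>)"
      by (simp add: sum_distrib_right mult.assoc)
    finally show "(\<integral>x. ?u x * of_real (pderivative k \<psi> x) \<partial>lebesgue_on \<Omega>)
        = - (\<integral>x. ?g x $ k * of_real (\<psi> x) \<partial>lebesgue_on \<Omega>)" .
  qed
  moreover have "?u \<in> L2 \<Omega>"
    using fL2 by (simp add: L2_iff_square_integrable square_integrable_sum)
  ultimately show ?thesis
    by (auto simp: H1_def)
qed

lemma P1_sum:
  assumes "\<And>j. j \<in> J \<Longrightarrow> f j \<in> P1 K"
  shows "(\<lambda>x. \<Sum>j\<in>J. c j * f j x) \<in> P1 K"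
proof -
  have "\<forall>j\<in>J. \<exists>a b. \<forall>x\<in>K. f j x = a + (\<Sum>k\<in>UNIV. b $ k * complex_of_real (x $ k))"
    using assms by (auto simp: P1_def)
  then obtain a b where ab: "\<forall>j\<in>J. \<forall>x\<in>K. f j x = a j + (\<Sum>k\<in>UNIV. b j $ k * complex_of_real (x $ k))"
    by metis
  have "(\<Sum>j\<in>J. c j * f j x) = (\<Sum>j\<in>J. c j * a j)
      + (\<Sum>k\<in>UNIV. (\<chi> k. \<Sum>j\<in>J. c j * b j $ k) $ k * complex_of_real (x $ k))" if "x \<in> K" for x
    using ab that
    by (simp add: sum.distrib distrib_left sum_distrib_left sum_distrib_right mult.assoc sum.swap[of _ _ J])
  then show ?thesis
    unfolding P1_def by blast
qed

lemma fe_space_sum: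
  fixes \<Omega> :: "(real ^ 'd) set"
  assumes "open \<Omega>" "bounded \<Omega>" "\<And>j. j \<in> J \<Longrightarrow> f j \<in> fe_space \<Omega> \<T>"
  shows "(\<lambda>x. \<Sum>j\<in>J. c j * f j x) \<in> fe_space \<Omega> \<T>"
  using assms by (simp add: fe_space_def H1_sum P1_sum)

lemma P1_continuous_on: "u \<in> P1 K \<Longrightarrow> continuous_on K u"
proof -
  assume "u \<in> P1 K"
  then obtain c b where u: "\<And>x. x \<in> K \<Longrightarrow> u x = c + (\<Sum>k\<in>UNIV. b $ k * complex_of_real (x $ k))"
    by (auto simp: P1_def)
  have "continuous_on K (\<lambda>x. c + (\<Sum>k\<in>UNIV. b $ k * complex_of_real (x $ k)))"
    by (intro continuous_intros)
  then show ?thesis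
    using u by (simp cong: continuous_on_cong)
qed

lemma fe_space_continuous_on:
  assumes mesh: "mesh_of \<Omega> \<T>" and u: "u \<in> fe_space \<Omega> \<T>"
  shows "continuous_on (closure \<Omega>) u"
proof -
  have "continuous_on (\<Union>K\<in>\<T>. K) u"
    using mesh u
    by (intro continuous_on_closed_Union P1_continuous_on)
       (auto simp: mesh_of_def triangulation_def fe_space_def dest: closed_simplex)
  then show ?thesis
    using mesh by (simp add: mesh_of_def)
qed

lemma mesh_nonempty:
  assumes "mesh_of \<Omega> \<T>" "\<Omega> \<noteq> {}"
  shows "\<T> \<noteq> {}"
  using assms closure_subset[of \<Omega>] by (auto simp: mesh_of_def)

text \<open>
  Without a positive mesh size the norm equivalence would carry no information.
\<close>

lemma mesh_size_pos:
  fixes \<Omega> :: "(real ^ 'd) set"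
  assumes mesh: "mesh_of \<Omega> \<T>" and "\<Omega> \<noteq> {}"
  shows "0 < mesh_size \<T>"
proof -
  obtain K where K: "K \<in> \<T>" using mesh_nonempty[OF assms] by blast
  have simplex: "int CARD('d) simplex K" and fin: "finite \<T>"
    using mesh K by (auto simp: mesh_of_def triangulation_def)
  have "aff_dim K = int CARD('d)" by (rule aff_dim_simplex[OF simplex])
  then have "aff_dim K > 0" by simp
  then have "K \<noteq> {}" and "\<nexists>p. K = {p}"
    by auto
  then obtain p q where pq: "p \<in> K" "q \<in> K" "p \<noteq> q"
    by blast
  have "0 < dist p q" using pq by simp
  also have "\<dots> \<le> diameter K"
    using diameter_bounded_bound[of K p q] compact_simplex[OF simplex] pq by (simp add: compact_imp_bounded)
  also have "\<dots> \<le> mesh_size \<T>"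
    unfolding mesh_size_def using fin K by simp
  finally show ?thesis .
qed

lemma nodal_basis_pos:
  fixes \<Omega> :: "(real ^ 'd) set"
  assumes mesh: "mesh_of \<Omega> \<T>" and "\<Omega> \<noteq> {}" and basis: "nodal_basis \<Omega> \<T> N \<phi>"
  shows "0 < N"
proof -
  obtain K where K: "K \<in> \<T>" using mesh_nonempty[OF assms(1,2)] by blast
  have simplex: "int CARD('d) simplex K"
    using mesh K by (auto simp: mesh_of_def)
  have "K \<noteq> {}" using aff_dim_simplex[OF simplex] by auto
  then obtain v where "v extreme_point_of K"
    using extreme_point_exists_convex[OF compact_simplex[OF simplex] convex_simplex[OF simplex]] by blast
  then have "mesh_vertices \<T> \<noteq> {}"
    using K by (auto simp: mesh_vertices_def)
  then show ?thesis
    using basis by (auto simp: nodal_basis_def bij_betw_def intro: gr0I)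
qed


section \<open>Hausdorff measure and covering numbers\<close>

text \<open>
  In Euclidean space this says that the upper \<open>n\<close>-dimensional Minkowski content is finite. Equal
  radii make the notion stable under finite unions and easy to bound by packing arguments.
\<close>

definition covering_content_bounded :: "nat \<Rightarrow> 'a::metric_space set \<Rightarrow> bool" where
  "covering_content_bounded n F \<longleftrightarrow>
     (\<exists>C. \<forall>\<eta>\<in>{0<..1}.
        \<exists>P. finite P \<and> F \<subseteq> (\<Union>p\<in>P. cball p \<eta>) \<and> real (card P) * \<eta> ^ n \<le> C)"

lemma covering_content_boundedI:
  assumes "\<And>\<eta>. 0 < \<eta> \<Longrightarrow> \<eta> \<le> 1 \<Longrightarrow>
    \<exists>P. finite P \<and> F \<subseteq> (\<Union>p\<in>P. cball p \<eta>) \<and> real (card P) * \<eta> ^ n \<le> C"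
  shows "covering_content_bounded n F"
  unfolding covering_content_bounded_def
  using assms by (intro exI[of _ C] ballI) simp

lemma covering_content_bounded_empty [simp]: "covering_content_bounded n {}"
  by (rule covering_content_boundedI[of _ _ 0], rule exI[of _ "{}"]) simp

lemma covering_content_bounded_subset:
  assumes G: "covering_content_bounded n G" and "F \<subseteq> G"
  shows "covering_content_bounded n F"
proof -
  obtain C where C: "\<forall>\<eta>\<in>{0<..1}.
      \<exists>P. finite P \<and> G \<subseteq> (\<Union>p\<in>P. cball p \<eta>) \<and> real (card P) * \<eta> ^ n \<le> C"
    using G unfolding covering_content_bounded_def by (rule exE)
  show ?thesis
  proof (rule covering_content_boundedI)
    fix \<eta> :: real assume "0 < \<eta>" "\<eta> \<le> 1"
    then have "\<eta> \<in> {0<..1}" by simp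
    from bspec[OF C this] obtain P
      where P: "finite P" "G \<subseteq> (\<Union>p\<in>P. cball p \<eta>)" "real (card P) * \<eta> ^ n \<le> C"
      by (elim exE conjE)
    show "\<exists>P. finite P \<and> F \<subseteq> (\<Union>p\<in>P. cball p \<eta>) \<and> real (card P) * \<eta> ^ n \<le> C"
      using P(1) order_trans[OF assms(2) P(2)] P(3) by (intro exI conjI)
  qed
qed

lemma covering_content_bounded_Un:
  assumes F: "covering_content_bounded n F" and G: "covering_content_bounded n G"
  shows "covering_content_bounded n (F \<union> G)"
proof -
  obtain C where C: "\<forall>\<eta>\<in>{0<..1}.
      \<exists>P. finite P \<and> F \<subseteq> (\<Union>p\<in>P. cball p \<eta>) \<and> real (card P) * \<eta> ^ n \<le> C"
    using F unfolding covering_content_bounded_def by (rule exE)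
  obtain D where D: "\<forall>\<eta>\<in>{0<..1}.
      \<exists>P. finite P \<and> G \<subseteq> (\<Union>p\<in>P. cball p \<eta>) \<and> real (card P) * \<eta> ^ n \<le> D"
    using G unfolding covering_content_bounded_def by (rule exE)
  have "\<exists>P. finite P \<and> F \<union> G \<subseteq> (\<Union>p\<in>P. cball p \<eta>) \<and> real (card P) * \<eta> ^ n \<le> C + D"
    if \<eta>: "0 < \<eta>" "\<eta> \<le> 1" for \<eta>
  proof -
    have "\<eta> \<in> {0<..1}" using \<eta> by simp
    note C = bspec[OF C this] and D = bspec[OF D this]
    obtain P where P: "finite P" "F \<subseteq> (\<Union>p\<in>P. cball p \<eta>)" "real (card P) * \<eta> ^ n \<le> C"
      using C by (elim exE conjE)
    obtain Q where Q: "finite Q" "G \<subseteq> (\<Union>p\<in>Q. cball p \<eta>)" "real (card Q) * \<eta> ^ n \<le> D"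
      using D by (elim exE conjE)
    have "real (card (P \<union> Q)) * \<eta> ^ n \<le> (real (card P) + real (card Q)) * \<eta> ^ n"
      using \<eta> card_Un_le[of P Q] by (intro mult_right_mono) (auto simp flip: of_nat_add)
    also have "\<dots> \<le> C + D"
      using P(3) Q(3) by (simp add: distrib_right)
    finally have "real (card (P \<union> Q)) * \<eta> ^ n \<le> C + D" .
    moreover have "F \<union> G \<subseteq> (\<Union>p\<in>P \<union> Q. cball p \<eta>)"
      unfolding UN_Un by (rule Un_mono[OF P(2) Q(2)])
    ultimately show ?thesis
      using finite_UnI[OF P(1) Q(1)] by (intro exI conjI)
  qed
  then show ?thesis
    by (rule covering_content_boundedI)
qed

lemma covering_content_bounded_UN:
  assumes "finite I" "\<And>i. i \<in> I \<Longrightarrow> covering_content_bounded n (F i)"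
  shows "covering_content_bounded n (\<Union>i\<in>I. F i)"
  using assms by (induction I) (auto simp: covering_content_bounded_Un)

text \<open>
  Balls of radius at most \<open>\<delta> / 2\<close> are admissible in the definition of the outer measure. The
  finite cover is continued to a sequence by empty sets, which contribute \<open>0 ^ n = 0\<close> because
  \<open>0 < n\<close>.
\<close>

lemma hausdorff_outer_finite:
  fixes F :: "'a::metric_space set"
  assumes F: "covering_content_bounded n F" and n: "0 < n"
  shows "hausdorff_outer n F < \<infinity>"
proof -
  obtain C where C: "\<forall>\<eta>\<in>{0<..1}.
      \<exists>P. finite P \<and> F \<subseteq> (\<Union>p\<in>P. cball p \<eta>) \<and> real (card P) * \<eta> ^ n \<le> C"
    using F unfolding covering_content_bounded_def by (rule exE)
  let ?v = "unit_ball_vol (real n)"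
  have "hausdorff_pre n \<delta> F \<le> ennreal (?v * C)" if \<delta>: "0 < \<delta>" for \<delta>
  proof -
    define \<eta> where "\<eta> = min 1 (\<delta> / 2)"
    have \<eta>: "0 < \<eta>" "\<eta> \<le> 1" "2 * \<eta> \<le> \<delta>" using \<delta> by (auto simp: \<eta>_def)
    then have "\<eta> \<in> {0<..1}" by simp
    then obtain P where P: "finite P" "F \<subseteq> (\<Union>p\<in>P. cball p \<eta>)" "real (card P) * \<eta> ^ n \<le> C"
      using C by (auto elim!: ballE)
    obtain h where h: "bij_betw h {..<card P} P"
      using ex_bij_betw_nat_finite[OF P(1)] by (auto simp: lessThan_atLeast0)
    define U where "U i = (if i < card P then cball (h i) \<eta> else {})" for i
    have diam: "diameter (U i) \<le> 2 * \<eta>" for i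
      unfolding diameter_def using \<eta>
    proof (simp, intro impI cSUP_least)
      assume "U i \<noteq> {}"
      then show "U i \<times> U i \<noteq> {}" by blast
    next
      fix xy assume "xy \<in> U i \<times> U i"
      then obtain x y where "xy = (x, y)" "dist (h i) x \<le> \<eta>" "dist (h i) y \<le> \<eta>"
        by (auto simp: U_def split: if_splits)
      then show "(case xy of (x, y) \<Rightarrow> dist x y) \<le> 2 * \<eta>"
        using dist_triangle3[of x y "h i"] by simp
    qed
    have cover: "F \<subseteq> (\<Union>i. U i)"
    proof
      fix x assume "x \<in> F"
      then obtain p where "p \<in> P" "x \<in> cball p \<eta>" using P(2) by blast
      moreover have "p \<in> h ` {..<card P}"
        using \<open>p \<in> P\<close> bij_betw_imp_surj_on[OF h] by simp
      then obtain i where "i < card P" "h i = p" by blast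
      ultimately show "x \<in> (\<Union>i. U i)" by (auto simp: U_def intro!: exI[of _ i])
    qed
    have "hausdorff_pre n \<delta> F \<le> (\<Sum>i. ennreal (?v * (diameter (U i) / 2) ^ n))"
      unfolding hausdorff_pre_def using cover order_trans[OF diam \<eta>(3)]
      by (intro INF_lower) (auto simp: U_def)
    also have "\<dots> = (\<Sum>i<card P. ennreal (?v * (diameter (U i) / 2) ^ n))"
      using n by (intro suminf_finite) (auto simp: U_def)
    also have "\<dots> \<le> (\<Sum>i<card P. ennreal (?v * \<eta> ^ n))"
    proof (intro sum_mono ennreal_leI mult_left_mono power_mono)
      fix i
      show "diameter (U i) / 2 \<le> \<eta>" using diam[of i] by simp
      have "bounded (U i)" by (simp add: U_def)
      then show "0 \<le> diameter (U i) / 2" using diameter_ge_0 by simp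
    qed simp
    also have "\<dots> = ennreal (?v * (real (card P) * \<eta> ^ n))"
      using \<eta> by (simp add: ennreal_of_nat_eq_real_of_nat flip: ennreal_mult)
    also have "\<dots> \<le> ennreal (?v * C)"
      using P(3) by (intro ennreal_leI mult_left_mono) auto
    finally show ?thesis .
  qed
  then have "hausdorff_outer n F \<le> ennreal (?v * C)"
    unfolding hausdorff_outer_def by (intro SUP_least) auto
  then show ?thesis
    by (simp add: order_le_less_trans)
qed

section \<open>Packing a set with Lipschitz inverse projection\<close>

text \<open>
  Balls of radius \<open>s / 2\<close> around \<open>s\<close>-separated points are disjoint, so their volumes add up.
\<close>

lemma card_mult_content_ball_le:
  fixes Q :: "'a::euclidean_space set"
  assumes "finite Q" "Q \<subseteq> ball 0 R" "0 < s" "s \<le> 2"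
    and sep: "\<And>p q. p \<in> Q \<Longrightarrow> q \<in> Q \<Longrightarrow> p \<noteq> q \<Longrightarrow> s \<le> dist p q"
  shows "real (card Q) * ((s / 2) ^ DIM('a) * measure lborel (ball (0 :: 'a) 1)) \<le> measure lborel (ball (0 :: 'a) (R + 1))"
proof -
  have fin: "emeasure lborel (ball p r) \<noteq> \<infinity>" for p :: 'a and r
    using emeasure_lborel_ball_finite[of p r] by (rule less_imp_neq)
  have disj: "disjoint_family_on (\<lambda>p. ball p (s / 2)) Q"
    unfolding disjoint_family_on_def
  proof safe
    fix p q x assume "p \<in> Q" "q \<in> Q" "p \<noteq> q" "x \<in> ball p (s / 2)" "x \<in> ball q (s / 2)"
    then show "x \<in> {}"
      using sep[of p q] dist_triangle2[of p q x] by (simp add: dist_commute)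
  qed
  have "real (card Q) * ((s / 2) ^ DIM('a) * measure lborel (ball (0 :: 'a) 1))
      = (\<Sum>p\<in>Q. measure lborel (ball p (s / 2)))"
    using assms(3) by (simp add: content_ball_conv_unit_ball[of "s / 2"])
  also have "\<dots> = measure lborel (\<Union>p\<in>Q. ball p (s / 2))"
    using assms(1) disj
    by (intro measure_finite_Union[symmetric]) (simp_all add: fin[simplified] image_subset_iff)
  also have "\<dots> \<le> measure lborel (ball (0 :: 'a) (R + 1))"
  proof (rule measure_mono_fmeasurable)
    show "(\<Union>p\<in>Q. ball p (s / 2)) \<subseteq> ball (0 :: 'a) (R + 1)"
    proof safe
      fix p x assume "p \<in> Q" "x \<in> ball p (s / 2)"
      moreover then have "dist 0 p < R" using assms(2) by auto
      ultimately show "x \<in> ball 0 (R + 1)"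
        using dist_triangle[of 0 x p] assms(4) by (simp add: dist_commute)
    qed
  qed (auto simp: fmeasurable_def emeasure_lborel_ball_finite[simplified] intro!: borel_open)
  finally show ?thesis .
qed

text \<open>
  A separated set of largest cardinality covers: a point at distance more than \<open>\<eta>\<close> from it could
  be added to it.
\<close>

lemma maximal_separated_net:
  fixes F :: "'a::metric_space set"
  assumes \<eta>: "0 \<le> \<eta>"
    and bound: "\<And>P. finite P \<Longrightarrow> P \<subseteq> F \<Longrightarrow> (\<forall>p\<in>P. \<forall>q\<in>P. p \<noteq> q \<longrightarrow> \<eta> < dist p q) \<Longrightarrow> card P \<le> k"
  obtains P where "finite P" "P \<subseteq> F" "\<forall>p\<in>P. \<forall>q\<in>P. p \<noteq> q \<longrightarrow> \<eta> < dist p q" "F \<subseteq> (\<Union>p\<in>P. cball p \<eta>)"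
proof -
  let ?S = "\<lambda>P. finite P \<and> P \<subseteq> F \<and> (\<forall>p\<in>P. \<forall>q\<in>P. p \<noteq> q \<longrightarrow> \<eta> < dist p q)"
  obtain P where P: "?S P" and max: "\<And>Q. ?S Q \<Longrightarrow> card Q \<le> card P"
    using ex_has_greatest_nat[of ?S "{}" card "Suc k"] bound by (auto simp: less_Suc_eq_le)
  have "F \<subseteq> (\<Union>p\<in>P. cball p \<eta>)"
  proof (rule ccontr)
    assume "\<not> F \<subseteq> (\<Union>p\<in>P. cball p \<eta>)"
    then obtain x where "x \<in> F" "x \<notin> (\<Union>p\<in>P. cball p \<eta>)" unfolding subset_iff by blast
    then have x: "x \<in> F" "\<forall>p\<in>P. \<eta> < dist p x" by (simp_all add: not_le)
    have "x \<notin> P"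
    proof
      assume "x \<in> P"
      with x(2) have "\<eta> < dist x x" by (rule bspec)
      then show False using \<eta> by simp
    qed
    have sym: "\<forall>p\<in>P. \<eta> < dist x p"
      using x(2) by (simp add: dist_commute[of x])
    have "?S (insert x P)"
    proof (intro conjI ballI impI)
      show "insert x P \<subseteq> F" using x(1) P by simp
      fix p q assume "p \<in> insert x P" "q \<in> insert x P" "p \<noteq> q"
      then show "\<eta> < dist p q" using P x(2) sym by (elim insertE) simp_all
    qed (use P in simp)
    then have "card (insert x P) \<le> card P" by (rule max)
    then show False using \<open>x \<notin> P\<close> P by simp
  qed
  then show thesis using P by (elim conjE, intro that)
qed

text \<open>
  If the orthogonal projection along \<open>e\<close> does not shorten distances in \<open>F\<close> by more than a factor
  \<open>c\<close>, then \<open>F\<close> has dimension at most \<open>DIM('a) - 1\<close>. For an \<open>\<eta>\<close>-separated subset \<open>P\<close>, stack about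
  \<open>1 / s\<close> translates of \<open>P\<close> by multiples of \<open>s e\<close>, where \<open>s = \<eta> / c\<close>. All points of the stack are
  \<open>s\<close>-separated: those over the same point by construction, the others already after projection.
  They lie in a fixed ball, so there are at most a constant times \<open>s\<close> to the power \<open>- DIM('a)\<close> of
  them, and \<open>P\<close> has fewer by the factor \<open>s\<close>.
\<close>

lemma covering_content_bounded_projection:
  fixes F :: "'a::euclidean_space set"
  assumes F: "bounded F" and e: "norm e = 1" and c: "1 \<le> c"
    and proj: "\<And>p q. p \<in> F \<Longrightarrow> q \<in> F \<Longrightarrow>
      dist p q \<le> c * dist (p - inner e p *\<^sub>R e) (q - inner e q *\<^sub>R e)"
  shows "covering_content_bounded (DIM('a) - 1) F"
proof -
  obtain R where R: "F \<subseteq> ball 0 R"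
    using bounded_subset_ballD[OF F] by blast
  define V where "V = measure lborel (ball (0 :: 'a) (R + 1 + 1))"
  define v where "v = measure lborel (ball (0 :: 'a) 1)"
  have v: "0 < v" unfolding v_def by (rule content_ball_pos) simp
  let ?n = "DIM('a) - 1"
  define D where "D = V * 2 ^ DIM('a) * c ^ ?n / v"
  have ee: "inner e e = 1" using e by (simp add: dot_square_norm)
  have packing: "real (card P) * \<eta> ^ ?n \<le> D"
    if P: "finite P" "P \<subseteq> F" "\<forall>p\<in>P. \<forall>q\<in>P. p \<noteq> q \<longrightarrow> \<eta> < dist p q" and \<eta>: "0 < \<eta>" "\<eta> \<le> 1" for P \<eta>
  proof -
    define s where "s = \<eta> / c"
    have s: "0 < s" "s \<le> 1" using \<eta> c by (auto simp: s_def field_simps)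
    define m where "m = nat \<lceil>1 / s\<rceil>"
    have m: "1 / s \<le> real m" "(real m - 1) * s < 1"
      using s by (auto simp: m_def pos_less_divide_eq[symmetric]) linarith+
    define f where "f = (\<lambda>(p, k :: nat). p + (real k * s) *\<^sub>R e)"
    have sep: "s \<le> dist (f (p, k)) (f (q, l))"
      if pq: "p \<in> P" "q \<in> P" "(p, k) \<noteq> (q, l)" for p q k l
    proof (cases "p = q")
      case True
      then have "k \<noteq> l" using that by simp
      then have "1 \<le> \<bar>real k - real l\<bar>" by linarith
      then have "s \<le> \<bar>real k - real l\<bar> * s" using s by simp
      also have "\<dots> = dist (f (p, k)) (f (q, l))"
        using True e s by (simp add: f_def dist_norm abs_mult flip: scaleR_diff_left left_diff_distrib)
      finally show ?thesis .
    next
      case False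
      define w where "w = f (p, k) - f (q, l)"
      have "\<eta> < c * dist (p - inner e p *\<^sub>R e) (q - inner e q *\<^sub>R e)"
        using P pq False proj[of p q] by force
      also have "(p - inner e p *\<^sub>R e) - (q - inner e q *\<^sub>R e) = w - inner e w *\<^sub>R e"
        by (simp add: w_def f_def inner_diff_right inner_add_right ee algebra_simps)
      then have "dist (p - inner e p *\<^sub>R e) (q - inner e q *\<^sub>R e) = norm (w - inner e w *\<^sub>R e)"
        by (simp add: dist_norm)
      also have "norm (w - inner e w *\<^sub>R e) \<le> norm w"
      proof (rule power2_le_imp_le)
        have "(norm (w - inner e w *\<^sub>R e))\<^sup>2 = (norm w)\<^sup>2 - (inner e w)\<^sup>2"
          unfolding power2_norm_eq_inner
          by (simp add: inner_diff_left inner_diff_right ee inner_commute[of w e] power2_eq_square)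
        then show "(norm (w - inner e w *\<^sub>R e))\<^sup>2 \<le> (norm w)\<^sup>2" by simp
      qed simp
      finally have "\<eta> < c * norm w" using c by simp
      then have "s < norm w" using c by (simp add: s_def pos_divide_less_eq mult.commute)
      then show ?thesis by (simp add: w_def dist_norm)
    qed
    let ?Q = "f ` (P \<times> {..<m})"
    have inj: "inj_on f (P \<times> {..<m})"
    proof (rule inj_onI, rule ccontr)
      fix a b assume ab: "a \<in> P \<times> {..<m}" "b \<in> P \<times> {..<m}" "f a = f b" "a \<noteq> b"
      then have "s \<le> dist (f a) (f b)"
        using sep[of "fst a" "fst b" "snd a" "snd b"] by (simp add: mem_Times_iff)
      then show False using ab(3) s by simp
    qed
    have "?Q \<subseteq> ball 0 (R + 1)"
    proof safe
      fix p k assume pk: "p \<in> P" "k < m"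
      have "real k * s \<le> (real m - 1) * s" using pk s by (intro mult_right_mono) auto
      then have "real k * s < 1" using m(2) by (rule order_le_less_trans)
      then have "norm ((real k * s) *\<^sub>R e) < 1" using s e by simp
      moreover have "norm p < R" using pk P R by auto
      ultimately show "f (p, k) \<in> ball 0 (R + 1)"
        using norm_triangle_ineq[of p "(real k * s) *\<^sub>R e"] by (simp add: f_def)
    qed
    moreover have "s \<le> dist a b" if ab: "a \<in> ?Q" "b \<in> ?Q" "a \<noteq> b" for a b
    proof -
      obtain p k q l where "a = f (p, k)" "b = f (q, l)" "p \<in> P" "q \<in> P"
        using ab(1,2) by auto
      then show ?thesis using sep[of p q k l] ab(3) by auto
    qed
    ultimately have "real (card ?Q) * ((s / 2) ^ DIM('a) * v) \<le> V"
      using card_mult_content_ball_le[of ?Q "R + 1" s] P(1) s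
      unfolding V_def v_def by simp
    then have *: "real (card P) * real m * ((s / 2) ^ DIM('a) * v) \<le> V"
      using inj by (simp add: card_image card_cartesian_product)
    have DIM: "DIM('a) = Suc ?n" using DIM_positive[where 'a='a] by linarith
    have "real (card P) * \<eta> ^ ?n = real (card P) * (1 / s) * s ^ DIM('a) * c ^ ?n"
    proof -
      have "s ^ DIM('a) = s * s ^ ?n" using DIM by (metis power_Suc)
      moreover have "\<eta> ^ ?n = s ^ ?n * c ^ ?n"
        using c by (simp add: s_def flip: power_mult_distrib)
      ultimately show ?thesis using s by simp
    qed
    also have "\<dots> \<le> real (card P) * real m * s ^ DIM('a) * c ^ ?n"
      using m s c by (intro mult_right_mono mult_left_mono) auto
    also have "\<dots> = (real (card P) * real m * ((s / 2) ^ DIM('a) * v)) * (2 ^ DIM('a) * c ^ ?n / v)"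
      using v by (simp add: power_divide)
    also have "\<dots> \<le> V * (2 ^ DIM('a) * c ^ ?n / v)"
      using * v c by (intro mult_right_mono) auto
    finally show ?thesis by (simp add: D_def)
  qed
  have "\<exists>P. finite P \<and> F \<subseteq> (\<Union>p\<in>P. cball p \<eta>) \<and> real (card P) * \<eta> ^ ?n \<le> D"
    if \<eta>: "0 < \<eta>" "\<eta> \<le> 1" for \<eta>
  proof (rule maximal_separated_net[OF less_imp_le[OF \<eta>(1)]])
      fix P assume P: "finite P" "P \<subseteq> F" "\<forall>p\<in>P. \<forall>q\<in>P. p \<noteq> q \<longrightarrow> \<eta> < dist p q"
      have "real (card P) \<le> D / \<eta> ^ ?n"
        using packing[OF P \<eta>] \<eta> by (simp add: pos_le_divide_eq)
      then show "card P \<le> nat \<lceil>D / \<eta> ^ ?n\<rceil>" by linarith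
    next
      fix P assume P: "finite P" "P \<subseteq> F" "\<forall>p\<in>P. \<forall>q\<in>P. p \<noteq> q \<longrightarrow> \<eta> < dist p q"
        and cover: "F \<subseteq> (\<Union>p\<in>P. cball p \<eta>)"
      show ?thesis
        using P(1) cover packing[OF P \<eta>] by (intro exI conjI)
  qed
  then show ?thesis
    by (rule covering_content_boundedI)
qed

section \<open>The surface measure of a Lipschitz boundary\<close>

text \<open>
  A boundary point is not in the open set \<open>\<Omega>\<close>, which gives one inequality; it is a limit of points
  of \<open>\<Omega>\<close>, which gives the other by continuity.
\<close>

lemma frontier_epigraph_subset_graph:
  fixes \<Omega> :: "(real ^ 'd) set"
  assumes "open \<Omega>" and g: "continuous_on UNIV g"
    and epi: "\<Omega> \<inter> ball p r = {y \<in> ball p r. g (y - inner e y *\<^sub>R e) < inner e y}"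
  shows "frontier \<Omega> \<inter> ball p r \<subseteq> {y. g (y - inner e y *\<^sub>R e) = inner e y}"
proof safe
  fix y assume y: "y \<in> frontier \<Omega>" "y \<in> ball p r"
  have "y \<notin> \<Omega>" using y assms(1) by (simp add: frontier_def interior_open)
  moreover have "y \<in> \<Omega> \<inter> ball p r" if "g (y - inner e y *\<^sub>R e) < inner e y"
    unfolding epi using y(2) that by simp
  ultimately have below: "inner e y \<le> g (y - inner e y *\<^sub>R e)"
    by (meson IntD1 not_le)
  have "y \<in> ball p r \<inter> closure \<Omega>" using y by (simp add: frontier_def)
  also have "\<dots> \<subseteq> closure (\<Omega> \<inter> ball p r)"
    using open_Int_closure_subset[of "ball p r" \<Omega>] by (simp only: open_ball Int_commute)
  also have "\<dots> \<subseteq> {y. g (y - inner e y *\<^sub>R e) \<le> inner e y}"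
    unfolding epi
  proof (rule closure_minimal)
    show "closed {y. g (y - inner e y *\<^sub>R e) \<le> inner e y}"
      by (intro closed_Collect_le continuous_intros continuous_on_compose2[OF g]) auto
  qed (simp add: subset_iff)
  finally show "g (y - inner e y *\<^sub>R e) = inner e y" using below by simp
qed

lemma lipschitz_graph_dist_le:
  assumes L: "L-lipschitz_on UNIV g" and e: "norm e = 1"
    and p: "g (p - inner e p *\<^sub>R e) = inner e p" and q: "g (q - inner e q *\<^sub>R e) = inner e q"
  shows "dist p q \<le> (1 + L) * dist (p - inner e p *\<^sub>R e) (q - inner e q *\<^sub>R e)"
proof -
  let ?p = "p - inner e p *\<^sub>R e" and ?q = "q - inner e q *\<^sub>R e"
  have "dist p q = norm ((?p - ?q) + (g ?p - g ?q) *\<^sub>R e)"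
    unfolding p q by (simp add: dist_norm algebra_simps)
  also have "\<dots> \<le> dist ?p ?q + dist (g ?p) (g ?q)"
    using norm_triangle_ineq[of "?p - ?q" "(g ?p - g ?q) *\<^sub>R e"] e by (simp add: dist_norm)
  also have "\<dots> \<le> dist ?p ?q + L * dist ?p ?q"
    using lipschitz_onD[OF L, of ?p ?q] by simp
  finally show ?thesis by (simp add: algebra_simps)
qed

lemma covering_content_bounded_frontier:
  fixes \<Omega> :: "(real ^ 'd) set"
  assumes \<Omega>: "bounded_lipschitz_domain \<Omega>"
  shows "covering_content_bounded (CARD('d) - 1) (frontier \<Omega>)"
proof -
  have op: "open \<Omega>" and bd: "bounded \<Omega>" 
    using \<Omega> by (auto simp: bounded_lipschitz_domain_def)
  have "\<exists>r>0. covering_content_bounded (CARD('d) - 1) (frontier \<Omega> \<inter> ball p r)" if p: "p \<in> frontier \<Omega>" for p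
  proof -
    obtain r e g L where r: "0 < r" and e: "norm e = 1" and L: "L-lipschitz_on UNIV g"
      and epi: "\<Omega> \<inter> ball p r = {y \<in> ball p r. g (y - inner e y *\<^sub>R e) < inner e y}"
      using \<Omega>[unfolded bounded_lipschitz_domain_def] p by (elim conjE) (drule (1) bspec, elim exE conjE)
    have graph: "frontier \<Omega> \<inter> ball p r \<subseteq> {y. g (y - inner e y *\<^sub>R e) = inner e y}"
      by (rule frontier_epigraph_subset_graph[OF op lipschitz_on_continuous_on[OF L] epi])
    have "covering_content_bounded (DIM(real ^ 'd) - 1) (frontier \<Omega> \<inter> ball p r)"
    proof (rule covering_content_bounded_projection[OF _ e, of _ "1 + L"])
      show "1 \<le> 1 + L" using lipschitz_on_nonneg[OF L] by simp
      show "dist x y \<le> (1 + L) * dist (x - inner e x *\<^sub>R e) (y - inner e y *\<^sub>R e)"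
        if "x \<in> frontier \<Omega> \<inter> ball p r" "y \<in> frontier \<Omega> \<inter> ball p r" for x y
        using that graph by (intro lipschitz_graph_dist_le[OF L e]) auto
    qed (auto intro: bounded_Int)
    then show ?thesis using r by (intro exI[of _ r] conjI) simp_all
  qed
  then have "\<forall>p\<in>frontier \<Omega>. \<exists>r. 0 < r \<and> covering_content_bounded (CARD('d) - 1) (frontier \<Omega> \<inter> ball p r)"
    by (rule ballI)
  from bchoice[OF this] obtain r where r: "\<forall>p\<in>frontier \<Omega>. 0 < r p \<and>
      covering_content_bounded (CARD('d) - 1) (frontier \<Omega> \<inter> ball p (r p))"
    by (rule exE)
  have cpt: "compact (frontier \<Omega>)" using bd by (rule compact_frontier_bounded)
  have cover: "frontier \<Omega> \<subseteq> (\<Union>p\<in>frontier \<Omega>. ball p (r p))"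
  proof
    fix x assume x: "x \<in> frontier \<Omega>"
    with r have "x \<in> ball x (r x)" by simp
    with x show "x \<in> (\<Union>p\<in>frontier \<Omega>. ball p (r p))" by (rule UN_I)
  qed
  obtain I where I: "I \<subseteq> frontier \<Omega>" "finite I" "frontier \<Omega> \<subseteq> (\<Union>p\<in>I. ball p (r p))"
    by (rule compactE_image[OF cpt open_ball cover])
  have "covering_content_bounded (CARD('d) - 1) (\<Union>p\<in>I. frontier \<Omega> \<inter> ball p (r p))"
    using I(1,2) r by (intro covering_content_bounded_UN) (simp_all add: subset_iff)
  moreover have "frontier \<Omega> \<subseteq> (\<Union>p\<in>I. frontier \<Omega> \<inter> ball p (r p))"
    using I(3) by (simp flip: Int_UN_distrib)
  ultimately show ?thesis
    by (rule covering_content_bounded_subset)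
qed

text \<open>
  On Borel sets \<^const>\<open>measure_of\<close> returns the given set function or, when that is not countably
  additive, the null measure, and it vanishes on all other sets. Every case lies below the outer
  measure.
\<close>

lemma emeasure_hausdorff_measure_le:
  "emeasure (hausdorff_measure n) A \<le> hausdorff_outer n A"
  by (simp add: hausdorff_measure_def emeasure_measure_of_conv)

lemma sets_hausdorff_measure: "sets (hausdorff_measure n) = sets (borel :: 'a::metric_space measure)"
  using sets.sigma_sets_eq[of "borel :: 'a measure"]
  by (simp add: hausdorff_measure_def sets_measure_of_conv)

lemma sets_surface_measure:
  "sets (surface_measure \<Omega>) = sets (restrict_space borel (frontier \<Omega>))"
  by (simp add: surface_measure_def sets_restrict_space sets_hausdorff_measure)

lemma space_surface_measure: "space (surface_measure \<Omega>) = frontier \<Omega>"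
  by (simp add: surface_measure_def hausdorff_measure_def space_restrict_space space_measure_of_conv)

text \<open>
  Finiteness of the surface measure ensures that continuous functions on the boundary are square
  integrable, hence that the boundary matrix is a genuine Gram matrix.
\<close>

lemma finite_measure_surface_measure:
  fixes \<Omega> :: "(real ^ 'd) set"
  assumes \<Omega>: "bounded_lipschitz_domain \<Omega>" and d: "2 \<le> CARD('d)"
  shows "finite_measure (surface_measure \<Omega>)"
proof (rule finite_measureI)
  have "emeasure (surface_measure \<Omega>) (frontier \<Omega>) = emeasure (hausdorff_measure (CARD('d) - 1)) (frontier \<Omega>)"
    unfolding surface_measure_def
    by (subst emeasure_restrict_space) (auto simp: sets_hausdorff_measure)
  also have "\<dots> \<le> hausdorff_outer (CARD('d) - 1) (frontier \<Omega>)"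
    by (rule emeasure_hausdorff_measure_le)
  also have "\<dots> < \<infinity>"
    using d by (intro hausdorff_outer_finite covering_content_bounded_frontier[OF \<Omega>]) auto
  finally show "emeasure (surface_measure \<Omega>) (space (surface_measure \<Omega>)) \<noteq> \<infinity>"
    by (simp add: space_surface_measure)
qed

lemma fe_space_square_integrable_boundary:
  fixes \<Omega> :: "(real ^ 'd) set"
  assumes \<Omega>: "bounded_lipschitz_domain \<Omega>" and d: "2 \<le> CARD('d)"
    and mesh: "mesh_of \<Omega> \<T>" and u: "u \<in> fe_space \<Omega> \<T>"
  shows "square_integrable (surface_measure \<Omega>) u"
proof -
  interpret finite_measure "surface_measure \<Omega>"
    by (rule finite_measure_surface_measure[OF \<Omega> d])
  have cont: "continuous_on (frontier \<Omega>) u"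
    using fe_space_continuous_on[OF mesh u] by (rule continuous_on_subset) (simp add: frontier_def)
  have meas [measurable]: "u \<in> borel_measurable (surface_measure \<Omega>)"
    using borel_measurable_continuous_on_restrict[OF cont]
    by (simp add: measurable_cong_sets[OF sets_surface_measure refl])
  have "compact (frontier \<Omega>)"
    using \<Omega> by (intro compact_frontier_bounded) (simp add: bounded_lipschitz_domain_def)
  then have "bounded (u ` frontier \<Omega>)"
    using cont by (intro compact_imp_bounded compact_continuous_image)
  then obtain b where b: "\<And>x. x \<in> frontier \<Omega> \<Longrightarrow> cmod (u x) \<le> b"
    by (auto simp: bounded_iff)
  have "integrable (surface_measure \<Omega>) (\<lambda>x. (cmod (u x))\<^sup>2)"
  proof (rule integrable_const_bound[of _ "b\<^sup>2"])
    show "AE x in surface_measure \<Omega>. norm ((cmod (u x))\<^sup>2) \<le> b\<^sup>2"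
      using b by (intro AE_I2) (simp add: space_surface_measure power_mono)
  qed measurable
  then show ?thesis
    using meas by (simp add: square_integrable_def)
qed


section \<open>The pseudospectrum of the preconditioned matrix\<close>

lemma outside_disc_iff:
  "z \<notin> closure (ball (1 / 2) (1 / 2)) \<longleftrightarrow> Re z < (cmod z)\<^sup>2"
proof -
  have "(dist (1 / 2) z)\<^sup>2 = (cmod z)\<^sup>2 - Re z + (1 / 2)\<^sup>2"
    unfolding dist_norm cmod_power2 by (simp add: power2_eq_square algebra_simps)
  moreover have "dist (1 / 2) z \<le> 1 / 2 \<longleftrightarrow> (dist (1 / 2) z)\<^sup>2 \<le> (1 / 2)\<^sup>2"
    using abs_le_square_iff[of "dist (1 / 2) z" "1 / 2 :: real"] by simp
  ultimately show ?thesis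
    by (auto simp: not_le)
qed

text \<open>
  The norm equivalence reads \<open>l |x|\<^sup>2 \<le> x\<^sup>* M x \<le> L |x|\<^sup>2\<close> with \<open>l = (c\<^sub>1 H)\<^sup>2\<close> and
  \<open>L = (C\<^sub>1 H)\<^sup>2\<close>, where \<open>H\<close> is the mesh size to the power \<open>d / 2\<close>; in \<open>L / l\<close> the mesh size cancels.
\<close>

lemma inverse_norm_galerkin_le:
  fixes \<Omega> :: "(real ^ 'd) set"
  assumes \<Omega>: "bounded_lipschitz_domain \<Omega>" and d: "2 \<le> CARD('d)"
    and c1: "0 < c1" and C1: "0 < C1"
    and mesh: "mesh_of \<Omega> \<T>" and basis: "nodal_basis \<Omega> \<T> N \<phi>"
    and equiv: "norm_equivalence \<Omega> \<T> N \<phi> c1 C1"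
    and \<kappa>: "0 < \<kappa>" and \<sigma>: "0 < \<sigma>" and z: "Re z < (cmod z)\<^sup>2"
  shows "inverse_norm (z \<cdot>\<^sub>m 1\<^sub>m N - galerkin_matrix N \<phi> (helmholtz_form \<Omega> \<kappa>)
            * mat_inv (galerkin_matrix N \<phi> (shifted_form \<Omega> \<kappa> \<sigma>)))
    \<le> ereal (1 / cmod (1 - z) + (C1 / c1)\<^sup>2 / ((cmod z)\<^sup>2 - Re z))"
proof -
  have op: "open \<Omega>" and bd: "bounded \<Omega>" and ne: "\<Omega> \<noteq> {}"
    using \<Omega> by (auto simp: bounded_lipschitz_domain_def)
  define H where "H = mesh_size \<T> powr (real CARD('d) / 2)"
  have H: "0 < H"
    using mesh_size_pos[OF mesh ne] by (simp add: H_def)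
  have fe: "(\<lambda>p. complex_of_real (\<phi> i p)) \<in> fe_space \<Omega> \<T>" if "i < N" for i
    using basis that by (auto simp: nodal_basis_def)
  then have H1: "(\<lambda>p. complex_of_real (\<phi> i p)) \<in> H1 \<Omega>" if "i < N" for i
    using that by (simp add: fe_space_def)
  then have L2: "(\<lambda>p. complex_of_real (\<phi> i p)) \<in> L2 \<Omega>" if "i < N" for i
    using that by (simp add: H1_def)
  let ?A = "galerkin_matrix N \<phi> (helmholtz_form \<Omega> \<kappa>)"
  let ?M = "galerkin_matrix N \<phi> (L2_inner \<Omega>)"
  let ?u = "\<lambda>x p. \<Sum>j<N. vec_index x j * complex_of_real (\<phi> j p)"
  have norms: "c1 * H * euclid_norm x \<le> L2_norm \<Omega> (?u x)"
      "L2_norm \<Omega> (?u x) \<le> C1 * H * euclid_norm x" if x: "x \<in> carrier_vec N" for x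
  proof -
    have "?u x \<in> fe_space \<Omega> \<T>"
      using fe by (intro fe_space_sum[OF op bd]) simp
    moreover have "coeff_vec_of \<Omega> N \<phi> (?u x) x"
      using x by (simp add: coeff_vec_of_def)
    ultimately show "c1 * H * euclid_norm x \<le> L2_norm \<Omega> (?u x)"
      "L2_norm \<Omega> (?u x) \<le> C1 * H * euclid_norm x"
      using equiv by (simp_all add: norm_equivalence_def H_def)
  qed
  have M_form: "(?M *\<^sub>v x) \<bullet>c x = of_real ((L2_norm \<Omega> (?u x))\<^sup>2)" if "x \<in> carrier_vec N" for x
    using L2 that by (rule galerkin_L2_form)
  have "inverse_norm (z \<cdot>\<^sub>m 1\<^sub>m N - ?A * mat_inv (galerkin_matrix N \<phi> (shifted_form \<Omega> \<kappa> \<sigma>)))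
    \<le> ereal (1 / cmod (1 - z) + ((C1 * H)\<^sup>2 / (c1 * H)\<^sup>2) / ((cmod z)\<^sup>2 - Re z))"
  proof (rule inverse_norm_preconditioned_le[where M = ?M and \<sigma> = \<sigma>])
    show "0 < N" by (rule nodal_basis_pos[OF mesh ne basis])
    show "(?M *\<^sub>v y) \<bullet>c x = cnj ((?M *\<^sub>v x) \<bullet>c y)"
      if "x \<in> carrier_vec N" "y \<in> carrier_vec N" for x y
      using that by (rule galerkin_L2_hermitian)
    show "(c1 * H)\<^sup>2 * (euclid_norm x)\<^sup>2 \<le> Re ((?M *\<^sub>v x) \<bullet>c x)" if x: "x \<in> carrier_vec N" for x
      using norms(1)[OF x] c1 H unfolding M_form[OF x] Re_complex_of_real
      by (subst power_mult_distrib[symmetric]) (rule power_mono, simp_all)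
    show "Re ((?M *\<^sub>v x) \<bullet>c x) \<le> (C1 * H)\<^sup>2 * (euclid_norm x)\<^sup>2" if x: "x \<in> carrier_vec N" for x
    proof -
      have "0 \<le> L2_norm \<Omega> (?u x)" by (simp add: L2_norm_def)
      with norms(2)[OF x] show ?thesis
        unfolding M_form[OF x] Re_complex_of_real
        by (subst power_mult_distrib[symmetric]) (rule power_mono)
    qed
    show "0 \<le> Im ((?A *\<^sub>v x) \<bullet>c x)" if x: "x \<in> carrier_vec N" for x
    proof -
      have "Im ((galerkin_matrix N \<phi> (grad_inner \<Omega>) *\<^sub>v x) \<bullet>c x) = 0"
        using galerkin_grad_real[OF H1 x] by (simp add: complex_is_Real_iff)
      moreover have "0 \<le> Re ((galerkin_matrix N \<phi> (bdry_inner \<Omega>) *\<^sub>v x) \<bullet>c x)"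
        using fe_space_square_integrable_boundary[OF \<Omega> d mesh fe] x
        by (rule galerkin_bdry_nonneg)
      ultimately show ?thesis
        unfolding galerkin_helmholtz_form[OF x x] M_form[OF x] using \<kappa> by simp
    qed
  qed (use c1 C1 H \<sigma> z galerkin_matrix_shifted in simp_all)
  moreover have "(C1 * H)\<^sup>2 / (c1 * H)\<^sup>2 = (C1 / c1)\<^sup>2"
    using H by (simp add: power_mult_distrib power_divide)
  ultimately show ?thesis by simp
qed

theorem lemma4p1:
  fixes \<Omega> :: "(real ^ 'd) set" and \<gamma> c1 C1 :: real
  assumes "CARD('d) = 2 \<or> CARD('d) = 3"
    and "bounded_lipschitz_domain \<Omega>"
    and "0 < c1" and "0 < C1"
  shows "\<exists>C>0. \<forall>(\<T> :: (real ^ 'd) set set) (N :: nat) (\<phi> :: nat \<Rightarrow> real ^ 'd \<Rightarrow> real)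
             (\<kappa> :: real) (\<sigma> :: real) (\<epsilon> :: real).
           mesh_of \<Omega> \<T> \<and> shape_regular \<gamma> \<T> \<and> nodal_basis \<Omega> \<T> N \<phi> \<and>
           norm_equivalence \<Omega> \<T> N \<phi> c1 C1 \<and> 0 < \<kappa> \<and> 0 < \<sigma> \<and> 0 < \<epsilon> \<longrightarrow>
           (let A = galerkin_matrix N \<phi> (helmholtz_form \<Omega> \<kappa>);
                B = galerkin_matrix N \<phi> (shifted_form \<Omega> \<kappa> \<sigma>)
            in {z :: complex. C * (1 / ((cmod z)\<^sup>2 - Re z) + 1 / cmod (1 - z)) < 1 / \<epsilon>}
                 - closure (ball (1 / 2) (1 / 2))
               \<subseteq> - pseudospectrum \<epsilon> (A * mat_inv B))"
proof (rule exI[of _ "max 1 ((C1 / c1)\<^sup>2)"], intro conjI allI impI, goal_cases)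
  case 1
  then show ?case by simp
next
  case (2 \<T> N \<phi> \<kappa> \<sigma> \<epsilon>)
  \<comment> \<open>The term \<open>1 / |1 - z|\<close> of the bound has coefficient one, hence the maximum.\<close>
  let ?C = "max 1 ((C1 / c1)\<^sup>2)"
  let ?A = "galerkin_matrix N \<phi> (helmholtz_form \<Omega> \<kappa>)"
  let ?B = "galerkin_matrix N \<phi> (shifted_form \<Omega> \<kappa> \<sigma>)"
  have d: "2 \<le> CARD('d)" using assms(1) by auto
  have "z \<notin> pseudospectrum \<epsilon> (?A * mat_inv ?B)"
    if z: "?C * (1 / ((cmod z)\<^sup>2 - Re z) + 1 / cmod (1 - z)) < 1 / \<epsilon>"
      and outside: "z \<notin> closure (ball (1 / 2) (1 / 2))" for z
  proof -
    have pos: "Re z < (cmod z)\<^sup>2"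
      using outside by (simp only: outside_disc_iff)
    let ?D = "(cmod z)\<^sup>2 - Re z" and ?r = "cmod (1 - z)"
    have dim: "dim_row (?A * mat_inv ?B) = N"
      by (simp add: galerkin_matrix_def)
    have "inverse_norm (z \<cdot>\<^sub>m 1\<^sub>m N - ?A * mat_inv ?B) \<le> ereal (1 / ?r + (C1 / c1)\<^sup>2 / ?D)"
      using 2 by (intro inverse_norm_galerkin_le[OF assms(2) d assms(3,4) _ _ _ _ _ pos]) auto
    also have "1 / ?r + (C1 / c1)\<^sup>2 / ?D \<le> ?C * (1 / ?D + 1 / ?r)"
    proof -
      have "1 * (1 / ?r) \<le> ?C * (1 / ?r)"
        by (rule mult_right_mono) simp_all
      moreover have "(C1 / c1)\<^sup>2 * (1 / ?D) \<le> ?C * (1 / ?D)"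
        using pos by (intro mult_right_mono) simp_all
      ultimately show ?thesis by (simp add: distrib_left)
    qed
    also note z
    finally show ?thesis
      unfolding pseudospectrum_def dim by (simp add: not_le)
  qed
  then show ?case
    unfolding Let_def by blast
qed

end
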